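(* Let $\mathcal{W}$ be a closed subspace of $\mathcal{H}$ such that for every function $q(z,w)\in\mathcal{W}$ there is a constant $c_q$ with $$\sum_{j=0}^{\infty}\left|T_{w}^{*j}q(0,w)\right|^{2}=c_q\qquad\text{for all } w\in\partial\mathbb{D}.$$ Then there is a minimal invariant subspace $\mathcal{M}$ of $B$ such that $$\mathcal{M}\ominus B\mathcal{M}=\mathcal{W}.$$
   Context: $\mathbb{D}$ is the open unit disc, $\mathbb{T}=\partial\mathbb{D}$ the unit circle. $H^2(\mathbb{T})$ is the Hardy space of the circle and $H^2(\mathbb{T}^2)=H^2(\mathbb{T})\otimes H^2(\mathbb{T})$ is the Hardy space of the bidisc, with variables $z,w$. Let $p_n(z,w)=\sum_{i=0}^{n}z^iw^{n-i}$ for $n\ge 0$, and let $\mathcal{H}$ be the closed linear span of $\{p_n\}_{n\ge0}$ in $H^2(\mathbb{T}^2)$; equivalently $\mathcal{H}=H^2(\mathbb{T}^2)\ominus[z-w]$, where $[z-w]$ is the closure of $(z-w)H^2(\mathbb{T}^2)$. Let $T_z,T_w$ be multiplication by $z$, $w$ on $H^2(\mathbb{T}^2)$, and let $P_{\mathcal{H}}$ be the orthogonal projection onto $\mathcal{H}$. The operator $B=P_{\mathcal{H}}T_z|_{\mathcal{H}}=P_{\mathcal{H}}T_w|_{\mathcal{H}}$ on $\mathcal{H}$ is unitarily equivalent to the Bergman shift (multiplication by the coordinate function on the Bergman space $L^2_a(\mathbb{D})$) and is called the Bergman shift here. An invariant subspace of $B$ is a closed subspace $\mathcal{M}\subseteq\mathcal{H}$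 with $B\mathcal{M}\subseteq\mathcal{M}$; its wandering subspace is $\mathcal{M}\ominus B\mathcal{M}=\mathcal{M}\cap(B\mathcal{M})^{\perp}$. "Minimal" is with respect to inclusion, among the invariant subspaces of $B$ with the stated property. For $q\in\mathcal{H}$, $q(0,w)$ denotes the function in $H^2(\mathbb{T})$ obtained by setting $z=0$, and $T_w^{*j}q(0,w)$ denotes the result of applying $T_w^{*j}$ to the function $q(0,\cdot)$, where on $H^2(\mathbb{T})$ the operator $T_w^*$ is the backward shift $\sum_{k\ge0}a_kw^k\mapsto\sum_{k\ge0}a_{k+1}w^k$. Functions on $\partial\mathbb{D}$ are boundary values, and identities between them are understood almost everywhere on $\partial\mathbb{D}$. *)

theory Defs
  imports "HOL-Analysis.Analysis"
begin

text \<open>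
  Elements of the Hardy space of the circle are represented by their power series
  \<open>\<Sum>k. a\<^sub>k w\<^sup>k\<close>, elements of the Hardy space of the bidisc by iterated power series
  \<open>\<Sum>i. (\<Sum>j. a\<^sub>i\<^sub>j w\<^sup>j) z\<^sup>i\<close> with square-summable coefficients.  The outer
  indeterminate is \<open>z\<close>, the inner one is \<open>w\<close>.
\<close>

abbreviation coeff2 :: "complex fps fps \<Rightarrow> nat \<Rightarrow> nat \<Rightarrow> complex"
  where "coeff2 f i j \<equiv> fps_nth (fps_nth f i) j"

definition var_z :: "complex fps fps"
  where "var_z = fps_X"

definition var_w :: "complex fps fps"
  where "var_w = fps_const fps_X"

definition scale2 :: "complex \<Rightarrow> complex fps fps \<Rightarrow> complex fps fps"
  where "scale2 c f = fps_const (fps_const c) * f"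

definition hardy_bidisc :: "complex fps fps set"
  where "hardy_bidisc = {f. (\<lambda>(i, j). (cmod (coeff2 f i j))\<^sup>2) summable_on UNIV}"

text \<open>
  The inner product of \<open>L\<^sup>2\<close> of the torus with normalized Haar measure, for which the
  monomials \<open>z\<^sup>i w\<^sup>j\<close> are orthonormal.
\<close>

definition inner2 :: "complex fps fps \<Rightarrow> complex fps fps \<Rightarrow> complex"
  where "inner2 f g = (\<Sum>\<^sub>\<infinity>(i, j)\<in>UNIV. coeff2 f i j * cnj (coeff2 g i j))"

definition norm2 :: "complex fps fps \<Rightarrow> real"
  where "norm2 f = sqrt (\<Sum>\<^sub>\<infinity>(i, j)\<in>UNIV. (cmod (coeff2 f i j))\<^sup>2)"

definition closed_subspace :: "complex fps fps set \<Rightarrow> bool"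
  where "closed_subspace V \<longleftrightarrow>
    V \<subseteq> hardy_bidisc \<and>
    0 \<in> V \<and>
    (\<forall>f\<in>V. \<forall>g\<in>V. f + g \<in> V) \<and>
    (\<forall>c. \<forall>f\<in>V. scale2 c f \<in> V) \<and>
    (\<forall>s. \<forall>f\<in>hardy_bidisc.
       (\<forall>n. s n \<in> V) \<and> (\<lambda>n. norm2 (s n - f)) \<longlonglongrightarrow> 0 \<longrightarrow> f \<in> V)"

definition closed_span :: "complex fps fps set \<Rightarrow> complex fps fps set"
  where "closed_span S = \<Inter> {V. closed_subspace V \<and> S \<subseteq> V}"

text \<open>Orthogonal projection; meaningful for closed subspaces \<open>V\<close> and \<open>f \<in> hardy_bidisc\<close>.\<close>

definition orth_proj :: "complex fps fps set \<Rightarrow> complex fps fps \<Rightarrow> complex fps fps"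
  where "orth_proj V f = (THE g. g \<in> V \<and> (\<forall>h\<in>V. inner2 (f - g) h = 0))"

definition p_poly :: "nat \<Rightarrow> complex fps fps"
  where "p_poly n = (\<Sum>i=0..n. var_z ^ i * var_w ^ (n - i))"

definition H_space :: "complex fps fps set"
  where "H_space = closed_span (range p_poly)"

definition bergman_shift :: "complex fps fps \<Rightarrow> complex fps fps"
  where "bergman_shift f = orth_proj H_space (var_z * f)"

definition invariant_subspace :: "complex fps fps set \<Rightarrow> bool"
  where "invariant_subspace M \<longleftrightarrow>
    closed_subspace M \<and> M \<subseteq> H_space \<and> bergman_shift ` M \<subseteq> M"

definition wandering_subspace :: "complex fps fps set \<Rightarrow> complex fps fps set"
  where "wandering_subspace M = {f \<in> M. \<forall>g\<in>bergman_shift ` M. inner2 f g = 0}"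

definition at_z_zero :: "complex fps fps \<Rightarrow> complex fps"
  where "at_z_zero q = fps_nth q 0"

definition backward_shift :: "complex fps \<Rightarrow> complex fps"
  where "backward_shift = fps_shift 1"

text \<open>
  Radial limits.  For square-summable coefficients the limit exists for almost every \<open>w\<close> on the
  unit circle (Fatou); elsewhere the value is unspecified.
\<close>

definition boundary_value :: "complex fps \<Rightarrow> complex \<Rightarrow> complex"
  where "boundary_value f w = Lim (at_left 1) (\<lambda>r::real. eval_fps f (of_real r * w))"

text \<open>Almost everywhere on the unit circle with respect to arc length.\<close>

definition ae_circle :: "(complex \<Rightarrow> bool) \<Rightarrow> bool"
  where "ae_circle P \<longleftrightarrow> (AE t in lebesgue_on {0..2 * pi}. P (cis t))"

end

theory Submission
  imports Defs
begin

text \<open>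
  A function in \<open>\<H>\<close> has the form \<open>q = \<Sum>n. a\<^sub>n p\<^sub>n\<close>, so its coefficient at
  \<open>z\<^sup>i w\<^sup>j\<close> is \<open>a\<^sub>i\<^sub>+\<^sub>j\<close>, its restriction \<open>q(0, w)\<close> has the coefficients \<open>a\<^sub>n\<close>, and
  \<open>\<Sum>n. (n + 1) |a\<^sub>n|\<^sup>2\<close> is finite.

  The hypothesis says that every \<open>q \<in> W\<close> is orthogonal to its iterates \<open>B\<^sup>k q\<close>, \<open>k \<ge> 1\<close>.
  Indeed the adjoint of multiplication by \<open>z\<close> is the backward shift in \<open>z\<close>, which maps
  \<open>\<H>\<close> into itself; so \<open>\<langle>q, B\<^sup>k q\<rangle>\<close> is the double series over \<open>i\<close> and \<open>n\<close> of
  \<open>a\<^sub>n\<^sub>+\<^sub>k\<^sub>+\<^sub>i\<close> times the conjugate of \<open>a\<^sub>n\<^sub>+\<^sub>i\<close>.  For fixed \<open>i\<close>, the sum over \<open>n\<close> is the \<open>k\<close>-th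
  Fourier coefficient of \<open>|T\<^sub>w\<^sup>*\<^sup>i q(0, w)|\<^sup>2\<close>, and the sum over \<open>i\<close> is therefore the \<open>k\<close>-th
  Fourier coefficient of a constant, which is zero
  (\<open>boundary_square_sum_const_imp_orthogonal\<close>, \<open>const_square_sum_imp_orthogonal\<close>).
  Polarization turns this into \<open>q \<bottom> B\<^sup>k r\<close> for all \<open>q, r \<in> W\<close> and \<open>k \<ge> 1\<close>.

  Let \<open>M\<close> be the closed span of the sets \<open>B\<^sup>k W\<close>.  It is invariant, and \<open>W\<close> is orthogonal to
  \<open>B M\<close>.  If \<open>f \<in> M\<close> is orthogonal to \<open>B M\<close> and \<open>q\<close> is the orthogonal projection of \<open>f\<close> to
  \<open>W\<close>, then \<open>f - q\<close> is orthogonal to \<open>W\<close> and to \<open>B M\<close>, hence to all \<open>B\<^sup>k W\<close>, hence to \<open>M\<close>,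
  hence zero.  So the wandering subspace of \<open>M\<close> is \<open>W\<close>.  Any invariant subspace with wandering
  subspace \<open>W\<close> contains \<open>W\<close>, hence all \<open>B\<^sup>k W\<close>, hence \<open>M\<close>; this is minimality.

  Two ingredients are analytic.  The projection to \<open>W\<close> needs the Hilbert projection theorem for
  square-summable families (\<open>projection_exists\<close>).  The Fourier coefficients of boundary values
  need radial limits and a dominated passage to them.  Since \<open>q(0, w)\<close> is in the Dirichlet space,
  Fatou's theorem can be bypassed.  Write \<open>f\<close> for \<open>q(0, w)\<close>.  For almost every direction the integral
  of \<open>|f'|\<^sup>2\<close> along the radius is finite, so that \<open>f\<close> is Hoelder continuous of order one half on
  that radius; and this integral controls \<open>|f|\<^sup>2\<close> on the whole radius (\<open>radial_variation\<close>,
  \<open>boundary_Parseval\<close>).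
\<close>

section \<open>The Hilbert space of the bidisc\<close>

text \<open>
  The coefficient array as one function on index pairs, so that linear statements can be checked
  pointwise and the library of unordered sums applies.
\<close>

definition coeff_fun :: "complex fps fps \<Rightarrow> nat \<times> nat \<Rightarrow> complex"
  where "coeff_fun f = (\<lambda>(i, j). coeff2 f i j)"

lemma coeff_fun_eqI: "(\<And>p. coeff_fun f p = coeff_fun g p) \<Longrightarrow> f = g"
  by (intro fps_ext) (force simp: coeff_fun_def)

lemma coeff_fun_add [simp]: "coeff_fun (f + g) p = coeff_fun f p + coeff_fun g p"
  and coeff_fun_diff [simp]: "coeff_fun (f - g) p = coeff_fun f p - coeff_fun g p"
  and coeff_fun_zero [simp]: "coeff_fun 0 p = 0"
  and coeff_fun_scale2 [simp]: "coeff_fun (scale2 c f) p = c * coeff_fun f p"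
  by (auto simp: coeff_fun_def scale2_def split: prod.split)

lemma hardy_bidisc_iff: "f \<in> hardy_bidisc \<longleftrightarrow> (\<lambda>p. (cmod (coeff_fun f p))\<^sup>2) summable_on UNIV"
  by (simp add: hardy_bidisc_def coeff_fun_def case_prod_unfold)

lemma inner2_eq: "inner2 f g = (\<Sum>\<^sub>\<infinity>p. coeff_fun f p * cnj (coeff_fun g p))"
  by (simp add: inner2_def coeff_fun_def case_prod_unfold)

lemma norm2_eq: "norm2 f = sqrt (\<Sum>\<^sub>\<infinity>p. (cmod (coeff_fun f p))\<^sup>2)"
  by (simp add: norm2_def coeff_fun_def case_prod_unfold)

lemma norm2_nonneg [simp]: "norm2 f \<ge> 0"
  by (simp add: norm2_eq infsum_nonneg)

lemma norm2_power2: "(norm2 f)\<^sup>2 = (\<Sum>\<^sub>\<infinity>p. (cmod (coeff_fun f p))\<^sup>2)"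
  by (simp add: norm2_eq infsum_nonneg)

text \<open>
  Bounds on finite partial sums survive pointwise limits, which makes this the way to show that
  limits and shifted arrays stay in the space.
\<close>

lemma hardy_bidiscI_finite_sums:
  assumes "\<And>F. finite F \<Longrightarrow> (\<Sum>p\<in>F. (cmod (coeff_fun f p))\<^sup>2) \<le> C\<^sup>2" and "C \<ge> 0"
  shows "f \<in> hardy_bidisc" and "norm2 f \<le> C"
proof -
  have s: "(\<lambda>p. (cmod (coeff_fun f p))\<^sup>2) summable_on UNIV"
    using assms(1) by (intro nonneg_bdd_above_summable_on bdd_aboveI2) auto
  then show "f \<in> hardy_bidisc" by (simp add: hardy_bidisc_iff)
  have "(norm2 f)\<^sup>2 \<le> C\<^sup>2"
    unfolding norm2_power2 by (rule infsum_le_finite_sums[OF s]) (use assms(1) in auto)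
  then show "norm2 f \<le> C"
    using assms(2) by (simp add: power2_le_iff_abs_le)
qed

lemma finite_sum_le_norm2:
  assumes "f \<in> hardy_bidisc" "finite F"
  shows "(\<Sum>p\<in>F. (cmod (coeff_fun f p))\<^sup>2) \<le> (norm2 f)\<^sup>2"
  unfolding norm2_power2
  by (rule finite_sum_le_infsum) (use assms in \<open>auto simp: hardy_bidisc_iff\<close>)

lemma coeff_le_norm2:
  assumes "f \<in> hardy_bidisc"
  shows "cmod (coeff_fun f p) \<le> norm2 f"
  using finite_sum_le_norm2[OF assms, of "{p}"] by (simp add: power2_le_iff_abs_le)

lemma norm2_eq_0D: "f \<in> hardy_bidisc \<Longrightarrow> norm2 f = 0 \<Longrightarrow> f = 0"
  using coeff_le_norm2[of f] by (intro coeff_fun_eqI) simp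

lemma cmod_add_power2_le: "(cmod (a + b))\<^sup>2 \<le> 2 * (cmod a)\<^sup>2 + 2 * (cmod b)\<^sup>2"
proof -
  have "(cmod (a + b))\<^sup>2 \<le> (cmod a + cmod b)\<^sup>2"
    by (simp add: norm_triangle_ineq power_mono)
  also have "\<dots> \<le> 2 * (cmod a)\<^sup>2 + 2 * (cmod b)\<^sup>2"
    using sum_squares_bound[of "cmod a" "cmod b"] by (simp add: power2_sum)
  finally show ?thesis .
qed

lemma hardy_zero [simp, intro]: "0 \<in> hardy_bidisc"
  by (simp add: hardy_bidisc_iff)

lemma hardy_scale2 [simp, intro]: "f \<in> hardy_bidisc \<Longrightarrow> scale2 c f \<in> hardy_bidisc"
  by (simp add: hardy_bidisc_iff norm_mult power_mult_distrib summable_on_cmult_right)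

lemma hardy_add [simp, intro]:
  assumes "f \<in> hardy_bidisc" "g \<in> hardy_bidisc"
  shows "f + g \<in> hardy_bidisc"
proof -
  have "(\<lambda>p. 2 * (cmod (coeff_fun f p))\<^sup>2 + 2 * (cmod (coeff_fun g p))\<^sup>2) summable_on UNIV"
    using assms by (intro summable_on_add summable_on_cmult_right) (auto simp: hardy_bidisc_iff)
  then show ?thesis
    unfolding hardy_bidisc_iff
    by (rule summable_on_comparison_test) (simp_all add: cmod_add_power2_le)
qed

lemma diff_eq_add_scale2: "f - g = f + scale2 (- 1) g"
  by (intro coeff_fun_eqI) simp

lemma hardy_diff [simp, intro]: "f \<in> hardy_bidisc \<Longrightarrow> g \<in> hardy_bidisc \<Longrightarrow> f - g \<in> hardy_bidisc"
  by (simp add: diff_eq_add_scale2)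

lemma mult_le_add_power2:
  fixes x y :: real
  assumes "x \<ge> 0" "y \<ge> 0"
  shows "x * y \<le> x\<^sup>2 + y\<^sup>2"
  using sum_squares_bound[of x y] mult_nonneg_nonneg[OF assms] by linarith

lemma inner2_abs_summable:
  assumes "f \<in> hardy_bidisc" "g \<in> hardy_bidisc"
  shows "(\<lambda>p. cmod (coeff_fun f p * cnj (coeff_fun g p))) summable_on UNIV"
proof -
  have sum: "(\<lambda>p. (cmod (coeff_fun f p))\<^sup>2 + (cmod (coeff_fun g p))\<^sup>2) summable_on UNIV"
    using assms by (intro summable_on_add) (auto simp: hardy_bidisc_iff)
  show ?thesis
    by (rule summable_on_comparison_test[OF sum]) (simp_all add: norm_mult mult_le_add_power2)
qed

lemma inner2_summable:
  assumes "f \<in> hardy_bidisc" "g \<in> hardy_bidisc"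
  shows "(\<lambda>p. coeff_fun f p * cnj (coeff_fun g p)) summable_on UNIV"
  using inner2_abs_summable[OF assms] by (rule abs_summable_summable)

lemma inner2_add_left:
  assumes "f \<in> hardy_bidisc" "g \<in> hardy_bidisc" "h \<in> hardy_bidisc"
  shows "inner2 (f + g) h = inner2 f h + inner2 g h"
  unfolding inner2_eq using assms
  by (simp add: ring_distribs infsum_add inner2_summable)

lemma inner2_scale2_left: "inner2 (scale2 c f) h = c * inner2 f h"
  by (simp add: inner2_eq mult.assoc infsum_cmult_right')

lemma inner2_commute: "inner2 f g = cnj (inner2 g f)"
  unfolding inner2_eq infsum_cnj[symmetric] by (simp add: mult.commute)

lemma inner2_add_right:
  assumes "f \<in> hardy_bidisc" "g \<in> hardy_bidisc" "h \<in> hardy_bidisc"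
  shows "inner2 h (f + g) = inner2 h f + inner2 h g"
  using inner2_add_left[OF assms] by (metis inner2_commute complex_cnj_add)

lemma inner2_scale2_right: "inner2 h (scale2 c f) = cnj c * inner2 h f"
  using inner2_scale2_left[of c f h] by (metis inner2_commute complex_cnj_mult)

lemma inner2_diff_left:
  assumes "f \<in> hardy_bidisc" "g \<in> hardy_bidisc" "h \<in> hardy_bidisc"
  shows "inner2 (f - g) h = inner2 f h - inner2 g h"
  using assms by (simp add: diff_eq_add_scale2 inner2_add_left inner2_scale2_left)

lemma inner2_diff_right:
  assumes "f \<in> hardy_bidisc" "g \<in> hardy_bidisc" "h \<in> hardy_bidisc"
  shows "inner2 h (f - g) = inner2 h f - inner2 h g"
  using assms by (simp add: diff_eq_add_scale2 inner2_add_right inner2_scale2_right)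

lemma inner2_zero [simp]: "inner2 0 f = 0" "inner2 f 0 = 0"
  by (simp_all add: inner2_eq)

lemma inner2_self:
  assumes "f \<in> hardy_bidisc"
  shows "inner2 f f = of_real ((norm2 f)\<^sup>2)"
proof -
  have "((\<lambda>p. complex_of_real ((cmod (coeff_fun f p))\<^sup>2)) has_sum of_real ((norm2 f)\<^sup>2)) UNIV"
    using assms unfolding has_sum_of_real_iff norm2_power2 hardy_bidisc_iff by (rule has_sum_infsum)
  then show ?thesis
    unfolding inner2_eq complex_norm_square by (rule infsumI)
qed

lemma norm2_scale2: "norm2 (scale2 c f) = cmod c * norm2 f"
  by (simp add: norm2_eq norm_mult power_mult_distrib infsum_cmult_right' real_sqrt_mult)

lemma norm2_add_power2:
  assumes "f \<in> hardy_bidisc" "g \<in> hardy_bidisc"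
  shows "(norm2 (f + g))\<^sup>2 = (norm2 f)\<^sup>2 + 2 * Re (inner2 f g) + (norm2 g)\<^sup>2"
proof -
  have "inner2 (f + g) (f + g) = inner2 f f + inner2 f g + cnj (inner2 f g) + inner2 g g"
    using assms by (simp add: inner2_add_left inner2_add_right flip: inner2_commute)
  then have "Re (inner2 (f + g) (f + g)) = Re (inner2 f f + inner2 f g + cnj (inner2 f g) + inner2 g g)"
    by simp
  then show ?thesis using assms by (simp add: inner2_self)
qed

lemma Cauchy_Schwarz_inner2:
  assumes "f \<in> hardy_bidisc" "g \<in> hardy_bidisc"
  shows "cmod (inner2 f g) \<le> norm2 f * norm2 g"
proof -
  have "cmod (inner2 f g) \<le> (\<Sum>\<^sub>\<infinity>p. cmod (coeff_fun f p * cnj (coeff_fun g p)))"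
    unfolding inner2_eq by (rule norm_infsum_bound[OF inner2_abs_summable[OF assms]])
  also have "\<dots> \<le> norm2 f * norm2 g"
  proof (rule infsum_le_finite_sums[OF inner2_abs_summable[OF assms]])
    fix F :: "(nat \<times> nat) set" assume "finite F"
    have "(\<Sum>p\<in>F. cmod (coeff_fun f p * cnj (coeff_fun g p)))
        = (\<Sum>p\<in>F. \<bar>cmod (coeff_fun f p)\<bar> * \<bar>cmod (coeff_fun g p)\<bar>)"
      by (simp add: norm_mult)
    also have "\<dots> \<le> L2_set (\<lambda>p. cmod (coeff_fun f p)) F * L2_set (\<lambda>p. cmod (coeff_fun g p)) F"
      by (rule L2_set_mult_ineq)
    also have "\<dots> \<le> norm2 f * norm2 g"
      unfolding L2_set_def using finite_sum_le_norm2[OF assms(1) \<open>finite F\<close>] finite_sum_le_norm2[OF assms(2) \<open>finite F\<close>]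
      by (intro mult_mono real_le_lsqrt) (auto intro: sum_nonneg)
    finally show "(\<Sum>p\<in>F. cmod (coeff_fun f p * cnj (coeff_fun g p))) \<le> norm2 f * norm2 g" .
  qed
  finally show ?thesis .
qed

lemma norm2_triangle:
  assumes "f \<in> hardy_bidisc" "g \<in> hardy_bidisc"
  shows "norm2 (f + g) \<le> norm2 f + norm2 g"
proof -
  have "(norm2 (f + g))\<^sup>2 \<le> (norm2 f + norm2 g)\<^sup>2"
    using norm2_add_power2[OF assms] Cauchy_Schwarz_inner2[OF assms] complex_Re_le_cmod[of "inner2 f g"]
    by (simp add: power2_sum)
  then show ?thesis by (simp add: power2_le_iff_abs_le)
qed

lemma norm2_parallelogram:
  assumes "f \<in> hardy_bidisc" "g \<in> hardy_bidisc"
  shows "(norm2 (f + g))\<^sup>2 + (norm2 (f - g))\<^sup>2 = 2 * (norm2 f)\<^sup>2 + 2 * (norm2 g)\<^sup>2"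
  using norm2_add_power2[OF assms] norm2_add_power2[of f "scale2 (-1) g"] assms
  unfolding diff_eq_add_scale2 by (simp add: inner2_scale2_right norm2_scale2)

text \<open>
  The coefficients of a Cauchy sequence converge one by one.  Letting \<open>n\<close> tend to infinity in the
  finite partial sums of \<open>norm2 (s m - s n)\<close> bounds those of \<open>s m - f\<close>.
\<close>

lemma hardy_bidisc_complete:
  assumes s: "\<And>n. s n \<in> hardy_bidisc"
    and cauchy: "\<And>e. e > 0 \<Longrightarrow> \<exists>N. \<forall>m\<ge>N. \<forall>n\<ge>N. norm2 (s m - s n) < e"
  shows "\<exists>f\<in>hardy_bidisc. (\<lambda>n. norm2 (s n - f)) \<longlonglongrightarrow> 0"
proof -
  have "Cauchy (\<lambda>n. coeff_fun (s n) p)" for p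
    unfolding Cauchy_def dist_norm
    using cauchy s by (metis coeff_fun_diff coeff_le_norm2 hardy_diff order_le_less_trans)
  then have "\<exists>l. (\<lambda>n. coeff_fun (s n) p) \<longlonglongrightarrow> l" for p
    by (simp add: Cauchy_convergent_iff convergent_def)
  then obtain l where l: "\<And>p. (\<lambda>n. coeff_fun (s n) p) \<longlonglongrightarrow> l p"
    by metis
  define f where "f = Abs_fps (\<lambda>i. Abs_fps (\<lambda>j. l (i, j)))"
  have f: "coeff_fun f p = l p" for p
    by (simp add: f_def coeff_fun_def split: prod.split)
  have tail: "s m - f \<in> hardy_bidisc \<and> norm2 (s m - f) \<le> e"
    if N: "\<forall>m\<ge>N. \<forall>n\<ge>N. norm2 (s m - s n) < e" and "m \<ge> N" "e > 0" for m N e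
  proof -
    have "(\<Sum>p\<in>F. (cmod (coeff_fun (s m - f) p))\<^sup>2) \<le> e\<^sup>2" if "finite F" for F
    proof (rule tendsto_upperbound)
      show "((\<lambda>n. \<Sum>p\<in>F. (cmod (coeff_fun (s m - s n) p))\<^sup>2)
              \<longlongrightarrow> (\<Sum>p\<in>F. (cmod (coeff_fun (s m - f) p))\<^sup>2)) sequentially"
        by (simp add: f) (intro tendsto_intros l)
      show "\<forall>\<^sub>F n in sequentially. (\<Sum>p\<in>F. (cmod (coeff_fun (s m - s n) p))\<^sup>2) \<le> e\<^sup>2"
      proof (rule eventually_sequentiallyI[of N])
        fix n assume "n \<ge> N"
        then have "(norm2 (s m - s n))\<^sup>2 \<le> e\<^sup>2"
          using N \<open>m \<ge> N\<close> by (intro power_mono) (auto simp: less_imp_le)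
        then show "(\<Sum>p\<in>F. (cmod (coeff_fun (s m - s n) p))\<^sup>2) \<le> e\<^sup>2"
          using finite_sum_le_norm2[of "s m - s n" F] s that by force
      qed
    qed auto
    then show ?thesis using hardy_bidiscI_finite_sums[of "s m - f" e] \<open>e > 0\<close> by auto
  qed
  obtain N where "\<forall>m\<ge>N. \<forall>n\<ge>N. norm2 (s m - s n) < 1"
    using cauchy[of 1] by auto
  then have "s N - f \<in> hardy_bidisc" using tail[of N 1 N] by simp
  then have "s N - (s N - f) \<in> hardy_bidisc" using s by blast
  then have "f \<in> hardy_bidisc" by simp
  moreover have "(\<lambda>n. norm2 (s n - f)) \<longlonglongrightarrow> 0"
  proof (rule LIMSEQ_I)
    fix r :: real assume "r > 0"
    then obtain N where "\<forall>m\<ge>N. \<forall>n\<ge>N. norm2 (s m - s n) < r / 2"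
      using cauchy[of "r/2"] by auto
    then show "\<exists>N. \<forall>n\<ge>N. norm (norm2 (s n - f) - 0) < r"
      using tail[of N "r/2"] \<open>r > 0\<close> by (intro exI[of _ N]) fastforce
  qed
  ultimately show ?thesis by blast
qed

lemma closed_subspaceD:
  assumes "closed_subspace V"
  shows "V \<subseteq> hardy_bidisc" "0 \<in> V" "f \<in> V \<Longrightarrow> g \<in> V \<Longrightarrow> f + g \<in> V" "f \<in> V \<Longrightarrow> scale2 c f \<in> V"
    "f \<in> V \<Longrightarrow> g \<in> V \<Longrightarrow> f - g \<in> V"
    "f \<in> hardy_bidisc \<Longrightarrow> (\<And>n. s n \<in> V) \<Longrightarrow> (\<lambda>n. norm2 (s n - f)) \<longlonglongrightarrow> 0 \<Longrightarrow> f \<in> V"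
proof -
  show "V \<subseteq> hardy_bidisc" "0 \<in> V" and add: "f \<in> V \<Longrightarrow> g \<in> V \<Longrightarrow> f + g \<in> V"
    and scale: "f \<in> V \<Longrightarrow> scale2 c f \<in> V" for f g c
    using assms by (simp_all add: closed_subspace_def)
  show "f \<in> V \<Longrightarrow> g \<in> V \<Longrightarrow> f - g \<in> V"
    unfolding diff_eq_add_scale2 by (intro add scale)
  show "f \<in> hardy_bidisc \<Longrightarrow> (\<And>n. s n \<in> V) \<Longrightarrow> (\<lambda>n. norm2 (s n - f)) \<longlonglongrightarrow> 0 \<Longrightarrow> f \<in> V"
    using assms unfolding closed_subspace_def by blast
qed

text \<open>
  A minimizing sequence for the distance from \<open>f\<close> to \<open>V\<close> is Cauchy by the parallelogram law, and
  its limit is a nearest point.  Moving this point by a small multiple of \<open>h\<close> cannot decrease the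
  distance, which forces orthogonality.
\<close>

lemma projection_exists:
  assumes V: "closed_subspace V" and f: "f \<in> hardy_bidisc"
  shows "\<exists>g\<in>V. \<forall>h\<in>V. inner2 (f - g) h = 0"
proof -
  note VD = closed_subspaceD[OF V]
  have Vh: "v \<in> V \<Longrightarrow> v \<in> hardy_bidisc" for v using VD(1) by auto
  define d where "d = (INF v\<in>V. (norm2 (f - v))\<^sup>2)"
  have d_le: "d \<le> (norm2 (f - v))\<^sup>2" if "v \<in> V" for v
    unfolding d_def by (rule cINF_lower[OF bdd_belowI2[where m = 0] that]) simp
  have "\<exists>v\<in>V. (norm2 (f - v))\<^sup>2 < d + 1 / Suc n" for n
  proof (rule ccontr)
    assume "\<not> ?thesis"
    then have "d + 1 / Suc n \<le> d"
      unfolding d_def using VD(2) by (intro cINF_greatest) (auto simp: not_less d_def)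
    then show False by (simp add: field_simps)
  qed
  then obtain s where s: "\<And>n. s n \<in> V" and sd: "\<And>n. (norm2 (f - s n))\<^sup>2 < d + 1 / Suc n"
    by metis
  have dist: "(norm2 (s m - s n))\<^sup>2 \<le> 2 / Suc m + 2 / Suc n" for m n
  proof -
    let ?c = "scale2 (1/2) (s m + s n)"
    have "(f - s n) + (f - s m) = scale2 2 (f - ?c)"
      by (intro coeff_fun_eqI, simp only: coeff_fun_add coeff_fun_diff coeff_fun_scale2)
        (simp add: field_simps)
    moreover have "(f - s n) - (f - s m) = s m - s n" by simp
    ultimately have "(2 * norm2 (f - ?c))\<^sup>2 + (norm2 (s m - s n))\<^sup>2
        = 2 * (norm2 (f - s n))\<^sup>2 + 2 * (norm2 (f - s m))\<^sup>2"
      using norm2_parallelogram[of "f - s n" "f - s m"] f s Vh by (simp add: norm2_scale2)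
    moreover have "d \<le> (norm2 (f - ?c))\<^sup>2" using s VD by (intro d_le) auto
    ultimately show ?thesis using sd[of m] sd[of n] by (simp add: power_mult_distrib)
  qed
  have cauchy: "\<exists>N. \<forall>m\<ge>N. \<forall>n\<ge>N. norm2 (s m - s n) < e" if "e > 0" for e
  proof -
    obtain N where N: "4 / e\<^sup>2 < real (Suc N)"
      by (metis lessI less_trans of_nat_less_iff reals_Archimedean2)
    have "norm2 (s m - s n) < e" if "m \<ge> N" "n \<ge> N" for m n
    proof -
      have "(norm2 (s m - s n))\<^sup>2 \<le> 2 / Suc m + 2 / Suc n" by (rule dist)
      also have "\<dots> \<le> 2 / Suc N + 2 / Suc N"
        using that by (intro add_mono divide_left_mono) auto
      also have "\<dots> = 4 / Suc N" by simp
      also have "\<dots> < e\<^sup>2" using N \<open>e > 0\<close> by (simp add: field_simps)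
      finally show ?thesis using \<open>e > 0\<close> by (simp add: power2_less_imp_less)
    qed
    then show ?thesis by blast
  qed
  obtain g where g: "g \<in> hardy_bidisc" and lim: "(\<lambda>n. norm2 (s n - g)) \<longlonglongrightarrow> 0"
    using hardy_bidisc_complete[OF Vh[OF s] cauchy] by auto
  have gV: "g \<in> V" by (rule VD(6)[OF g s lim])
  have "norm2 (f - g) \<le> sqrt d"
  proof (rule tendsto_lowerbound)
    have "(\<lambda>n. sqrt (d + 1 / Suc n) + norm2 (s n - g)) \<longlonglongrightarrow> sqrt (d + 0) + 0"
      by (intro tendsto_intros lim LIMSEQ_Suc[OF lim_1_over_n])
    then show "(\<lambda>n. sqrt (d + 1 / Suc n) + norm2 (s n - g)) \<longlonglongrightarrow> sqrt d" by simp
    have "norm2 (f - g) \<le> sqrt (d + 1 / Suc n) + norm2 (s n - g)" for n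
    proof -
      have "norm2 ((f - s n) + (s n - g)) \<le> norm2 (f - s n) + norm2 (s n - g)"
        using f g s Vh by (intro norm2_triangle) auto
      moreover have "norm2 (f - s n) \<le> sqrt (d + 1 / Suc n)"
        using sd[of n] by (intro real_le_rsqrt) simp
      ultimately show ?thesis by simp
    qed
    then show "\<forall>\<^sub>F n in sequentially. norm2 (f - g) \<le> sqrt (d + 1 / Suc n) + norm2 (s n - g)"
      by simp
  qed simp
  moreover have "d \<ge> 0" unfolding d_def using VD(2) by (intro cINF_greatest) auto
  ultimately have gd: "(norm2 (f - g))\<^sup>2 \<le> d"
    by (metis norm2_nonneg power_mono real_sqrt_pow2)
  have "inner2 (f - g) h = 0" if h: "h \<in> V" for h
  proof (rule ccontr)
    \<comment> \<open>The step in the direction \<open>a h\<close> lowers the squared distance by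
      \<open>t |a|\<^sup>2 (2 - t \<parallel>h\<parallel>\<^sup>2)\<close>; this \<open>t\<close> makes the last factor exceed one, also for \<open>h = 0\<close>.\<close>
    define a where "a = inner2 (f - g) h"
    define t where "t = 1 / ((norm2 h)\<^sup>2 + 1)"
    assume "inner2 (f - g) h \<noteq> 0"
    then have a: "cmod a > 0" by (simp add: a_def)
    have t: "t > 0" "t * (norm2 h)\<^sup>2 < 1" by (simp_all add: t_def add_nonneg_pos)
    have "d \<le> (norm2 (f - (g + scale2 (of_real t * a) h)))\<^sup>2"
      using gV h VD by (intro d_le) auto
    also have "f - (g + scale2 (of_real t * a) h) = (f - g) + scale2 (- of_real t * a) h"
      by (intro coeff_fun_eqI) simp
    also have "(norm2 \<dots>)\<^sup>2 = (norm2 (f - g))\<^sup>2 - 2 * t * (cmod a)\<^sup>2 + (t * cmod a * norm2 h)\<^sup>2"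
      using f g h Vh t(1)
      by (simp add: norm2_add_power2 inner2_scale2_right norm2_scale2 norm_mult
          cmod_power2 power2_eq_square[of "Re a"] power2_eq_square[of "Im a"] flip: a_def)
        (simp add: algebra_simps)
    also have "\<dots> \<le> d - t * (cmod a)\<^sup>2 * (2 - t * (norm2 h)\<^sup>2)"
      using gd by (simp add: algebra_simps power2_eq_square)
    finally have "t * (cmod a)\<^sup>2 * (2 - t * (norm2 h)\<^sup>2) \<le> 0" by simp
    moreover have "t * (cmod a)\<^sup>2 * (2 - t * (norm2 h)\<^sup>2) > 0"
      using a t by (intro mult_pos_pos) auto
    ultimately show False by simp
  qed
  with gV show ?thesis by blast
qed

lemma orth_proj_unique:
  assumes V: "closed_subspace V" and f: "f \<in> hardy_bidisc"
    and g: "g \<in> V" "\<And>h. h \<in> V \<Longrightarrow> inner2 (f - g) h = 0"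
    and g': "g' \<in> V" "\<And>h. h \<in> V \<Longrightarrow> inner2 (f - g') h = 0"
  shows "g = g'"
proof -
  note VD = closed_subspaceD[OF V]
  have m: "g - g' \<in> V" by (rule VD(5)[OF g(1) g'(1)])
  have "inner2 (g - g') (g - g') = inner2 ((f - g') - (f - g)) (g - g')" by simp
  also have "\<dots> = 0" 
    using g(1) g'(1) f VD(1) by (subst inner2_diff_left) (auto simp: g(2)[OF m] g'(2)[OF m])
  finally have "norm2 (g - g') = 0" using m VD(1) by (simp add: inner2_self subset_iff)
  then show ?thesis using m VD(1) norm2_eq_0D[of "g - g'"] by auto
qed

lemma orth_proj:
  assumes V: "closed_subspace V" and f: "f \<in> hardy_bidisc"
  shows orth_proj_in: "orth_proj V f \<in> V"
    and orth_proj_orth: "h \<in> V \<Longrightarrow> inner2 (f - orth_proj V f) h = 0"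
proof -
  have "\<exists>!g. g \<in> V \<and> (\<forall>h\<in>V. inner2 (f - g) h = 0)"
    using projection_exists[OF assms] orth_proj_unique[OF assms] by blast
  from theI'[OF this]
  show "orth_proj V f \<in> V" "h \<in> V \<Longrightarrow> inner2 (f - orth_proj V f) h = 0"
    by (auto simp: orth_proj_def)
qed

section \<open>Closed subspaces and closed spans\<close>

lemma closed_subspace_hardy: "closed_subspace hardy_bidisc"
  by (simp add: closed_subspace_def)

text \<open>The orthogonal complement of one vector is closed by the Cauchy-Schwarz inequality.\<close>

lemma closed_subspaceI_inner2:
  assumes "g \<in> hardy_bidisc"
  shows "closed_subspace {f \<in> hardy_bidisc. inner2 g f = 0}"
  unfolding closed_subspace_def
proof (intro conjI ballI allI impI)
  fix s f assume f: "f \<in> hardy_bidisc"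
    and s: "(\<forall>n. s n \<in> {f \<in> hardy_bidisc. inner2 g f = 0}) \<and> (\<lambda>n. norm2 (s n - f)) \<longlonglongrightarrow> 0"
  have bound: "cmod (inner2 g f) \<le> norm2 g * norm2 (s n - f)" for n
  proof -
    have "inner2 g f = - inner2 g (s n - f)"
      using s f assms by (simp add: inner2_diff_right)
    then show ?thesis
      using Cauchy_Schwarz_inner2[of g "s n - f"] s f assms by simp
  qed
  have "(\<lambda>n. norm2 g * norm2 (s n - f)) \<longlonglongrightarrow> norm2 g * 0"
    using s by (intro tendsto_intros) auto
  then have "cmod (inner2 g f) \<le> 0"
    by (intro LIMSEQ_le_const[where a = "cmod (inner2 g f)"]) (use bound in auto)
  with f show "f \<in> {f \<in> hardy_bidisc. inner2 g f = 0}" by simp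
qed (use assms in \<open>auto simp: inner2_add_right inner2_scale2_right\<close>)

lemma closed_subspace_closed_span:
  assumes "S \<subseteq> hardy_bidisc"
  shows "closed_subspace (closed_span S)"
  unfolding closed_subspace_def
proof (intro conjI ballI allI impI)
  show "closed_span S \<subseteq> hardy_bidisc"
    using assms closed_subspace_hardy by (auto simp: closed_span_def)
  show "0 \<in> closed_span S"
    by (simp add: closed_span_def closed_subspaceD(2))
  show "f + g \<in> closed_span S" if "f \<in> closed_span S" "g \<in> closed_span S" for f g
    using that unfolding closed_span_def by (simp add: closed_subspaceD(3))
  show "scale2 c f \<in> closed_span S" if "f \<in> closed_span S" for c f
    using that unfolding closed_span_def by (simp add: closed_subspaceD(4))
  fix s f assume f: "f \<in> hardy_bidisc"
    and s: "(\<forall>n. s n \<in> closed_span S) \<and> (\<lambda>n. norm2 (s n - f)) \<longlonglongrightarrow> 0"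
  show "f \<in> closed_span S"
    unfolding closed_span_def
  proof (rule InterI, clarify)
    fix V assume V: "closed_subspace V" "S \<subseteq> V"
    show "f \<in> V"
      by (rule closed_subspaceD(6)[OF V(1) f, of s]) (use s V in \<open>auto simp: closed_span_def\<close>)
  qed
qed

lemma closed_span_superset: "S \<subseteq> closed_span S"
  by (auto simp: closed_span_def)

lemma closed_span_minimal: "closed_subspace V \<Longrightarrow> S \<subseteq> V \<Longrightarrow> closed_span S \<subseteq> V"
  by (auto simp: closed_span_def)

text \<open>
  Together with the minimality of closed spans this transports an inclusion of the form
  \<open>T S \<subseteq> V\<close> from a set \<open>S\<close> to its closed span.
\<close>

lemma closed_subspace_vimage:
  assumes U: "closed_subspace U" and V: "closed_subspace V"
    and T: "\<And>f. f \<in> U \<Longrightarrow> T f \<in> hardy_bidisc"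
    and add: "\<And>f g. f \<in> U \<Longrightarrow> g \<in> U \<Longrightarrow> T (f + g) = T f + T g"
    and scale: "\<And>c f. f \<in> U \<Longrightarrow> T (scale2 c f) = scale2 c (T f)"
    and contr: "\<And>f. f \<in> U \<Longrightarrow> norm2 (T f) \<le> norm2 f"
  shows "closed_subspace {f \<in> U. T f \<in> V}"
  unfolding closed_subspace_def
proof (intro conjI ballI allI impI)
  note UD = closed_subspaceD[OF U] and VD = closed_subspaceD[OF V]
  show "{f \<in> U. T f \<in> V} \<subseteq> hardy_bidisc" using UD(1) by auto
  have scale0: "scale2 0 h = 0" for h by (intro coeff_fun_eqI) simp
  have "T 0 = 0" using scale[OF UD(2), of 0] by (simp only: scale0)
  then show "0 \<in> {f \<in> U. T f \<in> V}" using UD(2) VD(2) by simp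
  show "f + g \<in> {f \<in> U. T f \<in> V}" if "f \<in> {f \<in> U. T f \<in> V}" "g \<in> {f \<in> U. T f \<in> V}" for f g
    using that by (simp add: add UD(3) VD(3))
  show "scale2 c f \<in> {f \<in> U. T f \<in> V}" if "f \<in> {f \<in> U. T f \<in> V}" for c f
    using that by (simp add: scale UD(4) VD(4))
  fix s f assume f: "f \<in> hardy_bidisc"
    and "(\<forall>n. s n \<in> {f \<in> U. T f \<in> V}) \<and> (\<lambda>n. norm2 (s n - f)) \<longlonglongrightarrow> 0"
  then have s: "\<And>n. s n \<in> U" "\<And>n. T (s n) \<in> V" and lim: "(\<lambda>n. norm2 (s n - f)) \<longlonglongrightarrow> 0" by auto
  have fU: "f \<in> U" by (rule UD(6)[OF f s(1) lim])
  have diff: "T (s n) - T f = T (s n - f)" for n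
  proof -
    have "T (s n - f + f) = T (s n - f) + T f" using UD(5)[OF s(1) fU] fU by (rule add)
    then show ?thesis by simp
  qed
  have "(\<lambda>n. norm2 (T (s n) - T f)) \<longlonglongrightarrow> 0"
    unfolding diff
    by (rule tendsto_sandwich[OF _ _ tendsto_const lim]) (auto intro!: always_eventually contr UD(5) s(1) fU)
  then have "T f \<in> V" by (rule VD(6)[OF T[OF fU] s(2)])
  with fU show "f \<in> {f \<in> U. T f \<in> V}" by simp
qed

section \<open>Functions whose coefficients depend only on the total degree\<close>

text \<open>
  The adjoint of multiplication by \<open>z\<close> on the Hardy space of the bidisc; see \<open>inner2_var_z\<close>.
\<close>

definition shift_z :: "complex fps fps \<Rightarrow> complex fps fps"
  where "shift_z f = fps_shift 1 f"

lemma coeff2_shift_z [simp]: "coeff2 (shift_z f) i j = coeff2 f (Suc i) j"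
  by (simp add: shift_z_def)

lemma coeff_fun_shift_z [simp]: "coeff_fun (shift_z f) (i, j) = coeff_fun f (Suc i, j)"
  by (simp add: coeff_fun_def)

lemma coeff_fun_shift_z_eq: "coeff_fun (shift_z f) = coeff_fun f \<circ> map_prod Suc id"
  by (auto simp: fun_eq_iff)

lemma inj_map_prod_Suc: "inj_on (map_prod Suc id) A"
  by (auto simp: inj_on_def)

lemma coeff_fun_var_z:
  "coeff_fun (var_z * f) (0, j) = 0" "coeff_fun (var_z * f) (Suc i, j) = coeff_fun f (i, j)"
  by (simp_all add: coeff_fun_def var_z_def)

lemma coeff_fun_var_z_eq: "coeff_fun (var_z * f) \<circ> map_prod Suc id = coeff_fun f"
  by (auto simp: fun_eq_iff coeff_fun_var_z)

lemma coeff_fun_var_z_outside: "p \<notin> range (map_prod Suc id) \<Longrightarrow> coeff_fun (var_z * f) p = 0"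
  by (cases p; cases "fst p") (force simp: coeff_fun_var_z image_iff)+

lemma shift_z_hardy:
  assumes "f \<in> hardy_bidisc"
  shows "shift_z f \<in> hardy_bidisc" and "norm2 (shift_z f) \<le> norm2 f"
proof -
  have "(\<Sum>p\<in>F. (cmod (coeff_fun (shift_z f) p))\<^sup>2) \<le> (norm2 f)\<^sup>2" if "finite F" for F
  proof -
    have "(\<Sum>p\<in>F. (cmod (coeff_fun (shift_z f) p))\<^sup>2)
        = (\<Sum>p\<in>map_prod Suc id ` F. (cmod (coeff_fun f p))\<^sup>2)"
      by (subst sum.reindex[OF inj_map_prod_Suc]) (simp add: coeff_fun_shift_z_eq)
    also have "\<dots> \<le> (norm2 f)\<^sup>2" using that by (intro finite_sum_le_norm2 assms) simp
    finally show ?thesis .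
  qed
  from hardy_bidiscI_finite_sums[OF this]
  show "shift_z f \<in> hardy_bidisc" "norm2 (shift_z f) \<le> norm2 f" by simp_all
qed

lemma var_z_hardy:
  assumes "f \<in> hardy_bidisc"
  shows "var_z * f \<in> hardy_bidisc"
proof -
  have "(\<lambda>p. (cmod ((coeff_fun (var_z * f) \<circ> map_prod Suc id) p))\<^sup>2) summable_on UNIV"
    using assms by (simp only: coeff_fun_var_z_eq hardy_bidisc_iff)
  then have "(\<lambda>p. (cmod (coeff_fun (var_z * f) p))\<^sup>2) summable_on range (map_prod Suc id)"
    by (subst summable_on_reindex[OF inj_map_prod_Suc]) (simp add: o_def)
  also have "?this \<longleftrightarrow> (\<lambda>p. (cmod (coeff_fun (var_z * f) p))\<^sup>2) summable_on UNIV"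
    by (rule summable_on_cong_neutral) (auto simp: coeff_fun_var_z_outside)
  finally show ?thesis by (simp only: hardy_bidisc_iff)
qed

lemma inner2_var_z: "inner2 f (var_z * g) = inner2 (shift_z f) g"
proof -
  have "inner2 f (var_z * g)
      = (\<Sum>\<^sub>\<infinity>p\<in>range (map_prod Suc id). coeff_fun f p * cnj (coeff_fun (var_z * g) p))"
    unfolding inner2_eq by (rule infsum_cong_neutral) (auto simp: coeff_fun_var_z_outside)
  also have "\<dots> = (\<Sum>\<^sub>\<infinity>p. coeff_fun (shift_z f) p * cnj (coeff_fun g p))"
    by (subst infsum_reindex[OF inj_map_prod_Suc])
      (simp add: o_def coeff_fun_shift_z_eq flip: coeff_fun_var_z_eq[of g])
  finally show ?thesis by (simp only: inner2_eq)
qed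

lemma shift_z_add: "shift_z (f + g) = shift_z f + shift_z g"
  and shift_z_scale2: "shift_z (scale2 c f) = scale2 c (shift_z f)"
  by (intro coeff_fun_eqI; clarsimp)+

lemma coeff2_p_poly: "coeff2 (p_poly n) i j = (if i + j = n then 1 else 0)"
proof -
  have monomial: "coeff2 (var_z ^ l * var_w ^ m) i j = (if i = l \<and> j = m then 1 else 0)" for l m
    by (simp add: var_z_def var_w_def fps_X_power_mult_nth flip: fps_const_power)
       (auto simp: fps_X_power_nth)
  have "coeff2 (p_poly n) i j = (\<Sum>l=0..n. coeff2 (var_z ^ l * var_w ^ (n - l)) i j)"
    by (simp add: p_poly_def fps_sum_nth)
  also have "\<dots> = (\<Sum>l=0..n. if l = i then (if i + j = n then 1 else 0) else 0)"
    unfolding monomial by (intro sum.cong refl) auto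
  also have "\<dots> = (if i + j = n then 1 else 0)" by simp
  finally show ?thesis .
qed

lemma p_poly_hardy: "p_poly n \<in> hardy_bidisc"
  unfolding hardy_bidisc_def mem_Collect_eq
proof (rule summable_on_cong_neutral[THEN iffD1, OF _ _ _ summable_on_finite])
  show "finite ({..n} \<times> {..n})" by simp
qed (auto simp: coeff2_p_poly split: if_splits)

lemma closed_subspace_H_space: "closed_subspace H_space"
  unfolding H_space_def by (rule closed_subspace_closed_span) (auto simp: p_poly_hardy)

lemma H_space_hardy: "f \<in> H_space \<Longrightarrow> f \<in> hardy_bidisc"
  using closed_subspaceD(1)[OF closed_subspace_H_space] by auto

lemma shift_z_p_poly: "shift_z (p_poly n) = (if n = 0 then 0 else p_poly (n - 1))"
  by (intro fps_ext) (auto simp: coeff2_p_poly)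

lemma shift_z_H_space: "f \<in> H_space \<Longrightarrow> shift_z f \<in> H_space"
proof -
  have "closed_subspace {f \<in> hardy_bidisc. shift_z f \<in> H_space}"
    by (rule closed_subspace_vimage[OF closed_subspace_hardy closed_subspace_H_space])
      (simp_all add: shift_z_hardy shift_z_add shift_z_scale2)
  moreover have "range p_poly \<subseteq> {f \<in> hardy_bidisc. shift_z f \<in> H_space}"
    using closed_span_superset[of "range p_poly"] closed_subspaceD(2)[OF closed_subspace_H_space]
    unfolding H_space_def by (auto simp: p_poly_hardy shift_z_p_poly image_subset_iff)
  ultimately show "f \<in> H_space \<Longrightarrow> shift_z f \<in> H_space"
    using closed_span_minimal unfolding H_space_def by blast
qed

lemma coeff2_scale2: "coeff2 (scale2 c f) i j = c * coeff2 f i j"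
  by (simp add: scale2_def)

text \<open>
  The condition on the coefficients is closed because coefficients depend continuously on the
  function, and the spanning polynomials satisfy it.
\<close>

lemma H_space_coeff:
  assumes "f \<in> H_space"
  shows "coeff2 f i j = coeff2 f 0 (i + j)"
proof -
  have "closed_subspace {f \<in> hardy_bidisc. coeff2 f i j = coeff2 f 0 (i + j)}"
    (is "closed_subspace ?V") unfolding closed_subspace_def
  proof (intro conjI ballI allI impI)
    fix s f assume f: "f \<in> hardy_bidisc" and s: "(\<forall>n. s n \<in> ?V) \<and> (\<lambda>n. norm2 (s n - f)) \<longlonglongrightarrow> 0"
    have conv: "(\<lambda>n. coeff2 (s n) i' j') \<longlonglongrightarrow> coeff2 f i' j'" for i' j'
    proof (rule LIM_zero_cancel, rule Lim_null_comparison)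
      show "(\<lambda>n. norm2 (s n - f)) \<longlonglongrightarrow> 0" using s by simp
      show "\<forall>\<^sub>F n in sequentially. cmod (coeff2 (s n) i' j' - coeff2 f i' j') \<le> norm2 (s n - f)"
        using coeff_le_norm2[of "s _ - f" "(i', j')"] s f by (simp add: coeff_fun_def)
    qed
    have "coeff2 f i j = coeff2 f 0 (i + j)"
      using conv[of i j] conv[of 0 "i + j"] s by (intro LIMSEQ_unique[OF conv[of i j]]) auto
    with f show "f \<in> ?V" by simp
  qed (auto simp: coeff2_scale2)
  moreover have "range p_poly \<subseteq> ?V" by (auto simp: p_poly_hardy coeff2_p_poly)
  ultimately show ?thesis
    using assms closed_span_minimal unfolding H_space_def by blast
qed

section \<open>The Bergman shift\<close>

lemma bergman_shift_H_space: "f \<in> H_space \<Longrightarrow> bergman_shift f \<in> H_space"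
  unfolding bergman_shift_def by (intro orth_proj_in closed_subspace_H_space var_z_hardy H_space_hardy)

text \<open>
  Against elements of \<open>H_space\<close> the projection in the definition of the Bergman shift is invisible.
  Since the backward shift preserves \<open>H_space\<close>, this also determines the powers of the Bergman shift
  and gives linearity and contractivity without an explicit formula for it.
\<close>

lemma inner2_bergman_shift:
  assumes "q \<in> H_space" "f \<in> H_space"
  shows "inner2 q (bergman_shift f) = inner2 (shift_z q) f"
proof -
  have z: "var_z * f \<in> hardy_bidisc" using assms by (intro var_z_hardy H_space_hardy)
  have "inner2 (var_z * f - bergman_shift f) q = 0"
    unfolding bergman_shift_def by (rule orth_proj_orth[OF closed_subspace_H_space z assms(1)])
  then have "inner2 q (var_z * f - bergman_shift f) = 0"
    by (subst inner2_commute) simp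
  then have "inner2 q (bergman_shift f) = inner2 q (var_z * f)"
    using assms z bergman_shift_H_space H_space_hardy by (simp add: inner2_diff_right)
  then show ?thesis by (simp only: inner2_var_z)
qed

lemma H_space_eqI:
  assumes "f \<in> H_space" "g \<in> H_space" "\<And>q. q \<in> H_space \<Longrightarrow> inner2 q f = inner2 q g"
  shows "f = g"
proof -
  have m: "f - g \<in> H_space" by (rule closed_subspaceD(5)[OF closed_subspace_H_space assms(1,2)])
  have "inner2 (f - g) (f - g) = 0"
    using assms(3)[OF m] H_space_hardy[OF assms(1)] H_space_hardy[OF assms(2)] by (simp add: inner2_diff_right)
  then have "norm2 (f - g) = 0" using H_space_hardy[OF m] by (simp add: inner2_self)
  then show ?thesis using norm2_eq_0D[OF H_space_hardy[OF m]] by simp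
qed

lemma bergman_shift_add:
  assumes "f \<in> H_space" "g \<in> H_space"
  shows "bergman_shift (f + g) = bergman_shift f + bergman_shift g"
  using assms by (intro H_space_eqI) (simp_all add: inner2_bergman_shift inner2_add_right bergman_shift_H_space
      H_space_hardy shift_z_H_space closed_subspaceD(3)[OF closed_subspace_H_space])

lemma bergman_shift_scale2:
  assumes "f \<in> H_space"
  shows "bergman_shift (scale2 c f) = scale2 c (bergman_shift f)"
  using assms by (intro H_space_eqI) (simp_all add: inner2_bergman_shift inner2_scale2_right bergman_shift_H_space
      closed_subspaceD(4)[OF closed_subspace_H_space])

lemma bergman_shift_contraction:
  assumes "f \<in> H_space"
  shows "norm2 (bergman_shift f) \<le> norm2 f"
proof -
  let ?b = "bergman_shift f"
  note b = bergman_shift_H_space[OF assms]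
  have "(norm2 ?b)\<^sup>2 = cmod (inner2 ?b ?b)" using H_space_hardy[OF b] by (simp add: inner2_self norm_power)
  also have "\<dots> = cmod (inner2 (shift_z ?b) f)" by (simp only: inner2_bergman_shift[OF b assms])
  also have "\<dots> \<le> norm2 (shift_z ?b) * norm2 f"
    using assms b by (intro Cauchy_Schwarz_inner2 shift_z_hardy H_space_hardy)
  also have "\<dots> \<le> norm2 ?b * norm2 f"
    using b by (intro mult_right_mono shift_z_hardy H_space_hardy) auto
  finally have "norm2 ?b * norm2 ?b \<le> norm2 ?b * norm2 f" by (simp only: power2_eq_square)
  then show ?thesis
    by (cases "norm2 ?b = 0") (auto simp: mult_le_cancel_left order.strict_iff_order)
qed

lemma funpow_H_space: "(\<And>f. f \<in> H_space \<Longrightarrow> T f \<in> H_space) \<Longrightarrow> f \<in> H_space \<Longrightarrow> (T ^^ k) f \<in> H_space"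
  by (induction k) auto

lemma inner2_bergman_shift_funpow:
  assumes "q \<in> H_space" "f \<in> H_space"
  shows "inner2 q ((bergman_shift ^^ k) f) = inner2 ((shift_z ^^ k) q) f"
  using assms
proof (induction k arbitrary: q)
  case (Suc k)
  have "inner2 q ((bergman_shift ^^ Suc k) f) = inner2 (shift_z q) ((bergman_shift ^^ k) f)"
    using Suc.prems by (simp add: inner2_bergman_shift funpow_H_space bergman_shift_H_space)
  also have "\<dots> = inner2 ((shift_z ^^ k) (shift_z q)) f"
    using Suc.prems by (intro Suc.IH shift_z_H_space)
  finally show ?case by (simp add: funpow_swap1)
qed simp

section \<open>Parseval on the circle\<close>

definition circle_measure :: "real measure"
  where "circle_measure = restrict_space lborel {0..2*pi}"

lemma ae_circle_iff: "ae_circle P \<longleftrightarrow> (AE t in circle_measure. P (cis t))"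
  unfolding ae_circle_def circle_measure_def by (simp add: AE_restrict_space_iff AE_completion_iff)

lemma space_circle_measure [simp]: "space circle_measure = {0..2*pi}"
  by (simp add: circle_measure_def)

lemma finite_circle_measure: "finite_measure circle_measure"
  by (intro finite_measureI)
    (simp add: circle_measure_def emeasure_restrict_space)

interpretation circle: finite_measure circle_measure
  by (rule finite_circle_measure)

lemma measurable_circle_borel:
  "f \<in> borel_measurable borel \<Longrightarrow> f \<in> borel_measurable circle_measure"
  unfolding circle_measure_def by (intro measurable_restrict_space1) simp

lemma measurable_id_circle [measurable (raw)]: "(\<lambda>t. t) \<in> borel_measurable circle_measure"
  by (rule measurable_circle_borel) simp

lemma measurable_cis_borel [measurable]: "cis \<in> borel_measurable borel"
  by (intro borel_measurable_continuous_onI continuous_intros)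

lemma measurable_cis_circle [measurable]: "cis \<in> borel_measurable circle_measure"
  by (rule measurable_circle_borel) simp

lemma integrable_circle_bounded:
  fixes f :: "real \<Rightarrow> complex"
  assumes "f \<in> borel_measurable circle_measure" "\<And>t. norm (f t) \<le> C"
  shows "integrable circle_measure f"
  by (rule circle.integrable_const_bound[of _ C]) (use assms in auto)

text \<open>Orthogonality of the characters of the circle.\<close>

lemma integral_cis_circle:
  "(\<integral>t. cis (of_int m * t) \<partial>circle_measure) = (if m = 0 then 2 * pi else 0)"
proof (cases "m = 0")
  case True
  have "measure circle_measure {0..2*pi} = 2 * pi"
    by (simp add: circle_measure_def measure_restrict_space)
  with True show ?thesis by (simp add: scaleR_conv_of_real)
next
  case False
  have "(\<integral>t. cis (of_int m * t) \<partial>circle_measure)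
      = (\<integral>t. indicator {0..2*pi} t *\<^sub>R cis (of_int m * t) \<partial>lborel)"
    unfolding circle_measure_def by (rule integral_restrict_space) simp
  also have "\<dots> = cis (of_int m * (2 * pi)) / (\<i> * of_int m) - cis (of_int m * 0) / (\<i> * of_int m)"
  proof (rule integral_FTC_Icc)
    fix t :: real
    show "((\<lambda>t. cis (of_int m * t) / (\<i> * of_int m)) has_vector_derivative cis (of_int m * t))
        (at t within {0..2*pi})"
      unfolding has_vector_derivative_def
      by (rule derivative_eq_intros refl | use False in \<open>simp add: scaleR_conv_of_real field_simps\<close>)+
  qed (auto intro!: continuous_intros)
  also have "cis (of_int m * (2 * pi)) = 1"
    using cis_multiple_2pi[of "of_int m"] by (simp add: mult_ac)
  finally show ?thesis using False by simp
qed

text \<open>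
  The polynomial has \<open>k\<close> more terms than the sum on the right, so that every product
  \<open>b (n + k) * cnj (b n)\<close> with \<open>n < N\<close> occurs and no boundary case is left over.
\<close>

lemma trig_poly_Parseval:
  fixes b :: "nat \<Rightarrow> complex" and N k :: nat
  defines "p \<equiv> \<lambda>t. \<Sum>n<N + k. b n * cis (real n * t)"
  shows "(\<integral>t. of_real ((cmod (p t))\<^sup>2) * cis (- real k * t) \<partial>circle_measure)
       = 2 * pi * (\<Sum>n<N. b (n + k) * cnj (b n))"
proof -
  have "of_real ((cmod (p t))\<^sup>2) * cis (- real k * t)
      = (\<Sum>n<N + k. \<Sum>m<N + k. b m * cnj (b n) * cis (of_int (int m - int n - int k) * t))" for t
  proof -
    have "of_real ((cmod (p t))\<^sup>2) * cis (- real k * t) = p t * cnj (p t) * cis (- real k * t)"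
      by (simp only: complex_norm_square)
    also have "\<dots> = (\<Sum>n<N + k. \<Sum>m<N + k. (b m * cnj (b n)) *
        (cis (real m * t) * cis (- (real n * t)) * cis (- real k * t)))"
      by (simp add: p_def cnj_sum sum_distrib_left sum_distrib_right cis_cnj mult_ac)
    also have "\<dots> = (\<Sum>n<N + k. \<Sum>m<N + k. b m * cnj (b n) * cis (of_int (int m - int n - int k) * t))"
      unfolding cis_mult by (intro sum.cong refl) (simp add: algebra_simps)
    finally show ?thesis .
  qed
  then have "(\<integral>t. of_real ((cmod (p t))\<^sup>2) * cis (- real k * t) \<partial>circle_measure)
      = (\<Sum>n<N + k. \<Sum>m<N + k. b m * cnj (b n) * (if int m - int n - int k = 0 then 2 * pi else 0))"
    by (subst Bochner_Integration.integral_sum integral_mult_right_zero integral_cis_circle[symmetric]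
        | intro Bochner_Integration.integrable_sum integrable_mult_right
          integrable_circle_bounded[of _ 1] | simp)+
  also have "\<dots> = (\<Sum>n<N + k. if n < N then 2 * pi * (b (n + k) * cnj (b n)) else 0)"
  proof (intro sum.cong refl)
    fix n
    have "(\<Sum>m<N + k. b m * cnj (b n) * (if int m - int n - int k = 0 then 2 * pi else 0))
        = (\<Sum>m<N + k. if m = n + k then b m * cnj (b n) * (2 * pi) else 0)"
      by (intro sum.cong refl) auto
    also have "\<dots> = (if n < N then 2 * pi * (b (n + k) * cnj (b n)) else 0)"
      by (simp add: mult_ac)
    finally show "(\<Sum>m<N + k. b m * cnj (b n) * (if int m - int n - int k = 0 then 2 * pi else 0))
        = (if n < N then 2 * pi * (b (n + k) * cnj (b n)) else 0)" .
  qed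
  also have "\<dots> = (\<Sum>n<N. 2 * pi * (b (n + k) * cnj (b n)))"
    by (intro sum.mono_neutral_cong_right) auto
  finally show ?thesis by (simp add: sum_distrib_left)
qed

lemma summable_shift_mult_cnj:
  fixes b :: "nat \<Rightarrow> complex"
  assumes "summable (\<lambda>n. (cmod (b n))\<^sup>2)"
  shows "summable (\<lambda>n. cmod (b (n + k) * cnj (b n)))"
proof (rule summable_comparison_test')
  show "summable (\<lambda>n. (cmod (b (n + k)))\<^sup>2 + (cmod (b n))\<^sup>2)"
    using assms by (intro summable_add) (auto simp: summable_iff_shift[of "\<lambda>n. (cmod (b n))\<^sup>2"])
  show "norm (cmod (b (n + k) * cnj (b n))) \<le> (cmod (b (n + k)))\<^sup>2 + (cmod (b n))\<^sup>2" for n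
    by (simp add: norm_mult mult_le_add_power2)
qed

lemma abs_summable_imp_square_summable:
  fixes b :: "nat \<Rightarrow> complex"
  assumes "summable (\<lambda>n. cmod (b n))"
  shows "summable (\<lambda>n. (cmod (b n))\<^sup>2)"
proof (rule summable_comparison_test_ev[OF _ assms])
  have "\<forall>\<^sub>F n in sequentially. cmod (b n) < 1"
    using summable_LIMSEQ_zero[OF assms] by (rule order_tendstoD) simp
  then show "\<forall>\<^sub>F n in sequentially. norm ((cmod (b n))\<^sup>2) \<le> cmod (b n)"
    by eventually_elim (simp add: power2_eq_square mult_left_le)
qed

lemma abs_convergent_Parseval:
  fixes b :: "nat \<Rightarrow> complex"
  assumes b: "summable (\<lambda>n. cmod (b n))"
  defines "g \<equiv> \<lambda>t. \<Sum>n. b n * cis (real n * t)"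
  shows "(\<integral>t. of_real ((cmod (g t))\<^sup>2) * cis (- real k * t) \<partial>circle_measure)
       = 2 * pi * (\<Sum>n. b (n + k) * cnj (b n))"
proof (rule LIMSEQ_unique)
  define p where "p N t = (\<Sum>n<N + k. b n * cis (real n * t))" for N t
  define S where "S = (\<Sum>n. cmod (b n))"
  have lim: "(\<lambda>N. p N t) \<longlonglongrightarrow> g t" for t
  proof -
    have "summable (\<lambda>n. b n * cis (real n * t))"
      by (rule summable_norm_cancel) (use b in \<open>simp add: norm_mult\<close>)
    then have "(\<lambda>N. \<Sum>n<N. b n * cis (real n * t)) \<longlonglongrightarrow> g t"
      unfolding g_def by (rule summable_LIMSEQ)
    then show ?thesis unfolding p_def by (rule LIMSEQ_ignore_initial_segment)
  qed
  have bound: "cmod (p N t) \<le> S" for N t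
  proof -
    have "cmod (p N t) \<le> (\<Sum>n<N + k. cmod (b n))"
      unfolding p_def by (rule order_trans[OF norm_sum]) (simp add: norm_mult)
    also have "\<dots> \<le> S" unfolding S_def using b by (intro sum_le_suminf) auto
    finally show ?thesis .
  qed
  show "(\<lambda>N. \<integral>t. of_real ((cmod (p N t))\<^sup>2) * cis (- real k * t) \<partial>circle_measure)
      \<longlonglongrightarrow> (\<integral>t. of_real ((cmod (g t))\<^sup>2) * cis (- real k * t) \<partial>circle_measure)"
  proof (rule integral_dominated_convergence[where w = "\<lambda>_. S\<^sup>2"])
    show "(\<lambda>t. of_real ((cmod (g t))\<^sup>2) * cis (- real k * t)) \<in> borel_measurable circle_measure"
      unfolding g_def by measurable
    show "(\<lambda>t. of_real ((cmod (p N t))\<^sup>2) * cis (- real k * t)) \<in> borel_measurable circle_measure" for N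
      unfolding p_def by measurable
    show "AE t in circle_measure. norm (of_real ((cmod (p N t))\<^sup>2) * cis (- real k * t)) \<le> S\<^sup>2" for N
      using bound by (simp add: norm_mult norm_power power_mono)
    show "AE t in circle_measure. (\<lambda>N. of_real ((cmod (p N t))\<^sup>2) * cis (- real k * t))
        \<longlonglongrightarrow> of_real ((cmod (g t))\<^sup>2) * cis (- real k * t)"
      by (intro AE_I2 tendsto_intros lim)
  qed simp
  have "summable (\<lambda>n. b (n + k) * cnj (b n))"
    by (intro summable_norm_cancel[OF summable_shift_mult_cnj] abs_summable_imp_square_summable b)
  then show "(\<lambda>N. \<integral>t. of_real ((cmod (p N t))\<^sup>2) * cis (- real k * t) \<partial>circle_measure)
      \<longlonglongrightarrow> 2 * pi * (\<Sum>n. b (n + k) * cnj (b n))"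
    unfolding p_def trig_poly_Parseval by (intro tendsto_intros summable_LIMSEQ)
qed

lemma eval_fps_measurable [measurable]:
  fixes F :: "complex fps"
  assumes [measurable]: "h \<in> borel_measurable M"
  shows "(\<lambda>x. eval_fps F (h x)) \<in> borel_measurable M"
  unfolding eval_fps_def by measurable

lemma eval_fps_circle:
  fixes F :: "complex fps"
  shows "eval_fps F (of_real r * cis t) = (\<Sum>n. (fps_nth F n * of_real r ^ n) * cis (real n * t))"
  unfolding eval_fps_def power_mult_distrib Complex.DeMoivre mult.assoc ..

lemma summable_fps_radius:
  fixes F :: "complex fps"
  assumes "fps_conv_radius F \<ge> 1" "0 \<le> r" "r < 1"
  shows "summable (\<lambda>n. cmod (fps_nth F n * of_real r ^ n))"
proof (rule norm_summable_fps)
  have "ereal (norm (of_real r :: complex)) < 1" using assms by simp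
  then show "ereal (norm (of_real r :: complex)) < fps_conv_radius F"
    using assms(1) by (rule less_le_trans)
qed

lemma eval_fps_circle_bound:
  fixes F :: "complex fps"
  assumes "fps_conv_radius F \<ge> 1" "0 \<le> r" "r < 1"
  shows "cmod (eval_fps F (of_real r * cis t)) \<le> (\<Sum>n. cmod (fps_nth F n * of_real r ^ n))"
proof -
  have "cmod (\<Sum>n. (fps_nth F n * of_real r ^ n) * cis (real n * t))
      \<le> (\<Sum>n. cmod ((fps_nth F n * of_real r ^ n) * cis (real n * t)))"
    by (rule summable_norm) (use summable_fps_radius[OF assms] in \<open>simp add: norm_mult\<close>)
  then show ?thesis unfolding eval_fps_circle by (simp add: norm_mult)
qed

lemma Parseval_fps_circle:
  fixes F :: "complex fps"
  assumes "fps_conv_radius F \<ge> 1" "0 \<le> r" "r < 1"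
  shows "(\<integral>t. of_real ((cmod (eval_fps F (of_real r * cis t)))\<^sup>2) * cis (- real k * t) \<partial>circle_measure)
      = 2 * pi * (\<Sum>n. (fps_nth F (n + k) * of_real r ^ (n + k)) * cnj (fps_nth F n * of_real r ^ n))"
  unfolding eval_fps_circle by (rule abs_convergent_Parseval[OF summable_fps_radius[OF assms]])

lemma nn_Parseval_fps_circle:
  fixes F :: "complex fps"
  assumes F: "fps_conv_radius F \<ge> 1" "0 \<le> r" "r < 1"
  shows "(\<integral>\<^sup>+t. ennreal ((cmod (eval_fps F (of_real r * cis t)))\<^sup>2) \<partial>circle_measure)
      = (\<Sum>n. ennreal (2 * pi * (cmod (fps_nth F n))\<^sup>2 * r ^ (2 * n)))"
proof -
  let ?h = "\<lambda>t. (cmod (eval_fps F (of_real r * cis t)))\<^sup>2"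
  let ?S = "\<Sum>n. cmod (fps_nth F n * of_real r ^ n)"
  let ?b = "\<lambda>n. (cmod (fps_nth F n))\<^sup>2 * r ^ (2 * n)"
  have int: "integrable circle_measure ?h"
    by (rule circle.integrable_const_bound[of _ "?S\<^sup>2"])
      (auto intro!: power_mono eval_fps_circle_bound[OF F])
  have sq: "of_real (?b n) = (fps_nth F n * of_real r ^ n) * cnj (fps_nth F n * of_real r ^ n)" for n
    unfolding complex_norm_square[symmetric]
    using F(2) by (simp add: norm_mult norm_power power_mult_distrib power_even_eq power2_eq_square)
  have "summable (\<lambda>n. (cmod (fps_nth F n * of_real r ^ n))\<^sup>2)"
    by (rule abs_summable_imp_square_summable[OF summable_fps_radius[OF F]])
  then have summable: "summable ?b"
    using F(2) by (simp add: norm_mult norm_power power_mult_distrib flip: power_mult)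
      (simp add: mult.commute)
  have "complex_of_real (integral\<^sup>L circle_measure ?h)
      = (\<integral>t. of_real (?h t) * cis (- real 0 * t) \<partial>circle_measure)"
    unfolding integral_complex_of_real[symmetric] by simp
  also have "\<dots> = of_real (2 * pi) * (\<Sum>n. of_real (?b n))"
    unfolding Parseval_fps_circle[OF F] sq by simp
  also have "\<dots> = of_real (2 * pi * (\<Sum>n. ?b n))"
    using suminf_of_real[OF summable, where 'a = complex] by simp
  finally have "integral\<^sup>L circle_measure ?h = 2 * pi * (\<Sum>n. ?b n)"
    by (simp only: of_real_eq_iff)
  also have "\<dots> = (\<Sum>n. 2 * pi * ?b n)"
    by (rule suminf_mult[OF summable, symmetric])
  finally have "ennreal (integral\<^sup>L circle_measure ?h) = (\<Sum>n. ennreal (2 * pi * ?b n))"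
    by (subst suminf_ennreal2) (use summable_mult[OF summable, of "2 * pi"] F(2) in auto)
  moreover have "(\<integral>\<^sup>+t. ennreal (?h t) \<partial>circle_measure) = ennreal (integral\<^sup>L circle_measure ?h)"
    by (rule nn_integral_eq_integral[OF int]) simp
  ultimately show ?thesis by (simp add: mult.assoc)
qed

section \<open>Radial limits of functions in the Dirichlet space\<close>

text \<open>
  The Taylor coefficients of a function in the Dirichlet space of the disc.
\<close>

locale dirichlet_coeffs =
  fixes a :: "nat \<Rightarrow> complex"
  assumes dirichlet_summable: "summable (\<lambda>n. real (Suc n) * (cmod (a n))\<^sup>2)"
begin

abbreviation f :: "complex fps" where "f \<equiv> Abs_fps a"

lemma square_summable: "summable (\<lambda>n. (cmod (a n))\<^sup>2)"
  by (rule summable_comparison_test'[OF dirichlet_summable]) (simp add: mult_le_cancel_right1)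

lemma conv_radius_ge_1: "fps_conv_radius f \<ge> 1"
  unfolding fps_conv_radius_def
proof (rule conv_radius_geI_ex')
  fix r :: real assume r: "0 < r" "ereal r < 1"
  define C where "C = sqrt (\<Sum>n. (cmod (a n))\<^sup>2)"
  have C: "cmod (a n) \<le> C" for n
    unfolding C_def using sum_le_suminf[OF square_summable, of "{n}"]
    by (intro real_le_rsqrt) simp
  have "summable (\<lambda>n. C * r ^ n)"
    using r by (intro summable_mult summable_geometric) simp
  then show "summable (\<lambda>n. fps_nth f n * of_real r ^ n)"
    by (rule summable_comparison_test') (use r C in \<open>simp add: norm_mult norm_power mult_right_mono\<close>)
qed

lemma conv_radius_deriv_ge_1: "fps_conv_radius (fps_deriv f) \<ge> 1"
  using conv_radius_ge_1 fps_conv_radius_deriv by (rule order_trans)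

definition radial_energy :: "real \<Rightarrow> ennreal"
  where "radial_energy t = (\<integral>\<^sup>+\<rho>. ennreal ((cmod (eval_fps (fps_deriv f) (of_real \<rho> * cis t)))\<^sup>2)
    * indicator {0..<1} \<rho> \<partial>lborel)"

lemma radial_energy_measurable [measurable]: "radial_energy \<in> borel_measurable circle_measure"
  unfolding radial_energy_def[abs_def] by measurable

text \<open>
  By Tonelli the integral is taken over circles first.  Parseval for \<open>f'\<close> and
  \<open>\<integral>\<rho>\<^sup>2\<^sup>n d\<rho> = 1 / (2n + 1)\<close> leave the terms \<open>(n + 1)\<^sup>2 |a\<^sub>n\<^sub>+\<^sub>1|\<^sup>2 / (2n + 1)\<close>, which are
  dominated by those of the Dirichlet series.
\<close>

lemma integral_radial_energy_finite: "(\<integral>\<^sup>+t. radial_energy t \<partial>circle_measure) < \<infinity>"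
proof -
  interpret pair_sigma_finite circle_measure lborel
    by (simp add: pair_sigma_finite_def circle.sigma_finite_measure_axioms lborel.sigma_finite_measure_axioms)
  let ?d = "fps_nth (fps_deriv f)"
  let ?D = "\<lambda>n. real (Suc (Suc n)) * (cmod (a (Suc n)))\<^sup>2"
  have sD: "summable (\<lambda>n. 2 * pi * ?D n)"
    using dirichlet_summable by (intro summable_mult) (subst summable_Suc_iff)
  have "(\<integral>\<^sup>+t. radial_energy t \<partial>circle_measure)
      = (\<integral>\<^sup>+\<rho>. (\<integral>\<^sup>+t. ennreal ((cmod (eval_fps (fps_deriv f) (of_real \<rho> * cis t)))\<^sup>2)
          * indicator {0..<1} \<rho> \<partial>circle_measure) \<partial>lborel)"
    unfolding radial_energy_def by (rule Fubini'[symmetric]) measurable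
  also have "\<dots> \<le> (\<integral>\<^sup>+\<rho>. (\<Sum>n. ennreal (2 * pi * (cmod (?d n))\<^sup>2 * \<rho> ^ (2 * n)) * indicator {0..1} \<rho>) \<partial>lborel)"
  proof (rule nn_integral_mono)
    fix \<rho> :: real
    show "(\<integral>\<^sup>+t. ennreal ((cmod (eval_fps (fps_deriv f) (of_real \<rho> * cis t)))\<^sup>2)
          * indicator {0..<1} \<rho> \<partial>circle_measure)
        \<le> (\<Sum>n. ennreal (2 * pi * (cmod (?d n))\<^sup>2 * \<rho> ^ (2 * n)) * indicator {0..1} \<rho>)"
    proof (cases "\<rho> \<in> {0..<1}")
      case True
      then have "indicator {0..<1} \<rho> = (1 :: ennreal)" "indicator {0..1} \<rho> = (1 :: ennreal)"
        by simp_all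
      then show ?thesis
        using nn_Parseval_fps_circle[OF conv_radius_deriv_ge_1, of \<rho>] True
        by (simp only: mult_1_right atLeastLessThan_iff order_refl)
    next
      case False
      then have "indicator {0..<1} \<rho> = (0 :: ennreal)" by simp
      then show ?thesis by (simp only: mult_zero_right nn_integral_const) simp
    qed
  qed
  also have "\<dots> = (\<Sum>n. \<integral>\<^sup>+\<rho>. ennreal (2 * pi * (cmod (?d n))\<^sup>2 * \<rho> ^ (2 * n)) * indicator {0..1} \<rho> \<partial>lborel)"
    by (rule nn_integral_suminf) measurable
  also have "\<dots> \<le> (\<Sum>n. ennreal (2 * pi * ?D n))"
  proof (rule suminf_le)
    fix n
    let ?c = "2 * pi * (cmod (?d n))\<^sup>2"
    have "(\<integral>\<^sup>+\<rho>. ennreal (?c * \<rho> ^ (2 * n)) * indicator {0..1} \<rho> \<partial>lborel)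
        = ennreal (?c * 1 ^ Suc (2 * n) / real (Suc (2 * n)) - ?c * 0 ^ Suc (2 * n) / real (Suc (2 * n)))"
      by (rule nn_integral_FTC_Icc)
        (auto intro!: derivative_eq_intros simp del: power_Suc of_nat_Suc simp: field_simps)
    also have "\<dots> \<le> ennreal (2 * pi * ?D n)"
    proof (rule ennreal_leI)
      have "(real (Suc n))\<^sup>2 / real (Suc (2 * n)) \<le> real (Suc (Suc n))"
        by (simp add: field_simps power2_eq_square)
      from mult_right_mono[OF this, of "2 * pi * (cmod (a (Suc n)))\<^sup>2"]
      show "?c * 1 ^ Suc (2 * n) / real (Suc (2 * n)) - ?c * 0 ^ Suc (2 * n) / real (Suc (2 * n))
          \<le> 2 * pi * ?D n"
        by (simp add: norm_mult power_mult_distrib mult_ac del: of_nat_Suc)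
    qed
    finally show "(\<integral>\<^sup>+\<rho>. ennreal (?c * \<rho> ^ (2 * n)) * indicator {0..1} \<rho> \<partial>lborel)
        \<le> ennreal (2 * pi * ?D n)" .
  qed auto
  also have "\<dots> = ennreal (\<Sum>n. 2 * pi * ?D n)"
    by (rule suminf_ennreal2[OF _ sD]) simp
  also have "\<dots> < \<infinity>" by simp
  finally show ?thesis .
qed

lemma AE_radial_energy_finite: "AE t in circle_measure. radial_energy t < \<infinity>"
  using nn_integral_PInf_AE[OF radial_energy_measurable] integral_radial_energy_finite
  by (auto simp: less_top)

text \<open>
  The fundamental theorem of calculus along the radius, followed by the Cauchy-Schwarz inequality.
\<close>

lemma radial_variation:
  assumes "0 \<le> s" "s \<le> r" "r < 1"
  shows "ennreal ((cmod (eval_fps f (of_real r * cis t) - eval_fps f (of_real s * cis t)))\<^sup>2)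
      \<le> ennreal (r - s) * radial_energy t"
proof -
  let ?g = "\<lambda>\<rho>. eval_fps (fps_deriv f) (of_real \<rho> * cis t)"
  have rad: "ereal (cmod (of_real \<rho> * cis t)) < fps_conv_radius f"
    "ereal (cmod (of_real \<rho> * cis t)) < fps_conv_radius (fps_deriv f)" if "\<rho> \<in> {s..r}" for \<rho>
  proof -
    have "ereal (cmod (of_real \<rho> * cis t)) < 1" using that assms by (simp add: norm_mult)
    then show "ereal (cmod (of_real \<rho> * cis t)) < fps_conv_radius f"
      "ereal (cmod (of_real \<rho> * cis t)) < fps_conv_radius (fps_deriv f)"
      using conv_radius_ge_1 conv_radius_deriv_ge_1 by (blast intro: less_le_trans)+
  qed
  have cont: "continuous_on {s..r} (\<lambda>\<rho>. cis t * ?g \<rho>)"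
    using rad(2) by (intro continuous_intros continuous_on_eval_fps') auto
  have int: "integrable lborel (\<lambda>\<rho>. indicator {s..r} \<rho> *\<^sub>R (cis t * ?g \<rho>))"
    by (rule borel_integrable_compact[OF _ cont]) simp
  have "(\<integral>\<rho>. indicator {s..r} \<rho> *\<^sub>R (cis t * ?g \<rho>) \<partial>lborel)
      = eval_fps f (of_real r * cis t) - eval_fps f (of_real s * cis t)"
  proof (rule integral_FTC_Icc[OF assms(2) _ cont])
    fix \<rho> assume \<rho>: "s \<le> \<rho>" "\<rho> \<le> r"
    have "(eval_fps f has_field_derivative ?g \<rho>) (at (of_real \<rho> * cis t))"
      using rad(1)[of \<rho>] \<rho> by (intro has_field_derivative_eval_fps) auto
    moreover have "((\<lambda>\<rho>. of_real \<rho> * cis t) has_vector_derivative cis t) (at \<rho> within {s..r})"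
      by (auto intro!: derivative_eq_intros simp: has_vector_derivative_def scaleR_conv_of_real)
    ultimately show "((\<lambda>\<rho>. eval_fps f (of_real \<rho> * cis t)) has_vector_derivative cis t * ?g \<rho>)
        (at \<rho> within {s..r})"
      using field_vector_diff_chain_within[of "\<lambda>\<rho>. of_real \<rho> * cis t" "cis t" \<rho> "{s..r}" "eval_fps f" "?g \<rho>"]
      by (auto simp: o_def intro: has_field_derivative_at_within)
  qed
  then have "ennreal (cmod (eval_fps f (of_real r * cis t) - eval_fps f (of_real s * cis t)))
      \<le> (\<integral>\<^sup>+\<rho>. ennreal (cmod (indicator {s..r} \<rho> *\<^sub>R (cis t * ?g \<rho>))) \<partial>lborel)"
    using integral_norm_bound_ennreal[OF int] by simp
  also have "\<dots> = (\<integral>\<^sup>+\<rho>. indicator {s..r} \<rho> * (ennreal (cmod (?g \<rho>)) * indicator {0..<1} \<rho>) \<partial>lborel)"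
    using assms by (intro nn_integral_cong) (auto simp: norm_mult split: split_indicator)
  finally have "(ennreal (cmod (eval_fps f (of_real r * cis t) - eval_fps f (of_real s * cis t))))\<^sup>2
      \<le> (\<integral>\<^sup>+\<rho>. indicator {s..r} \<rho> * (ennreal (cmod (?g \<rho>)) * indicator {0..<1} \<rho>) \<partial>lborel)\<^sup>2"
    by (intro power_mono) auto
  also have "\<dots> \<le> (\<integral>\<^sup>+\<rho>. (indicator {s..r} \<rho>)\<^sup>2 \<partial>lborel)
      * (\<integral>\<^sup>+\<rho>. (ennreal (cmod (?g \<rho>)) * indicator {0..<1} \<rho>)\<^sup>2 \<partial>lborel)"
    by (rule Cauchy_Schwarz_nn_integral) measurable
  also have "(\<integral>\<^sup>+\<rho>. (indicator {s..r} \<rho>)\<^sup>2 \<partial>lborel) = (\<integral>\<^sup>+\<rho>. indicator {s..r} \<rho> \<partial>lborel)"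
    by (intro nn_integral_cong) (auto split: split_indicator)
  also have "\<dots> = ennreal (r - s)" using assms by simp
  also have "(\<integral>\<^sup>+\<rho>. (ennreal (cmod (?g \<rho>)) * indicator {0..<1} \<rho>)\<^sup>2 \<partial>lborel) = radial_energy t"
    unfolding radial_energy_def by (intro nn_integral_cong) (auto simp: ennreal_power split: split_indicator)
  finally show ?thesis by (simp add: ennreal_power)
qed

text \<open>
  The variation bound makes \<open>f\<close> Hoelder continuous of order one half on the radius, hence uniformly
  continuous, so that it extends to the end point.
\<close>

lemma radial_limit_exists:
  assumes "radial_energy t < \<infinity>"
  shows "\<exists>l. ((\<lambda>r. eval_fps f (of_real r * cis t)) \<longlongrightarrow> l) (at_left 1)"
proof -
  define e where "e = enn2real (radial_energy t)"
  have e: "radial_energy t = ennreal e" "e \<ge> 0" using assms by (simp_all add: e_def)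
  let ?\<phi> = "\<lambda>r::real. eval_fps f (of_real r * cis t)"
  have var: "(cmod (?\<phi> r - ?\<phi> s))\<^sup>2 \<le> (r - s) * e" if "0 \<le> s" "s \<le> r" "r < 1" for r s
    using radial_variation[OF that, of t] that e by (simp add: ennreal_mult[symmetric])
  have var_abs: "(cmod (?\<phi> r - ?\<phi> s))\<^sup>2 \<le> \<bar>r - s\<bar> * e" if "r \<in> {0..<1}" "s \<in> {0..<1}" for r s
    using var[of s r] var[of r s] that by (cases "s \<le> r") (auto simp: norm_minus_commute)
  have "uniformly_continuous_on {0..<1} ?\<phi>"
    unfolding uniformly_continuous_on_def dist_norm
  proof (intro allI impI)
    fix \<epsilon> :: real assume \<epsilon>: "\<epsilon> > 0"
    have "norm (?\<phi> s - ?\<phi> r) < \<epsilon>"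
      if rs: "r \<in> {0..<1}" "s \<in> {0..<1}" and d: "norm (s - r) < \<epsilon>\<^sup>2 / (e + 1)" for r s
    proof -
      have "(cmod (?\<phi> s - ?\<phi> r))\<^sup>2 \<le> \<bar>s - r\<bar> * e" by (rule var_abs[OF rs(2,1)])
      also have "\<dots> \<le> \<bar>s - r\<bar> * (e + 1)" by (simp add: mult_left_mono)
      also have "\<dots> < \<epsilon>\<^sup>2" using d e(2) by (simp add: field_simps)
      finally show ?thesis using \<epsilon> by (simp add: power2_less_imp_less)
    qed
    moreover have "\<epsilon>\<^sup>2 / (e + 1) > 0" using \<epsilon> e(2) by simp
    ultimately show "\<exists>d>0. \<forall>x\<in>{0..<1}. \<forall>x'\<in>{0..<1}. norm (x' - x) < d \<longrightarrow> norm (?\<phi> x' - ?\<phi> x) < \<epsilon>"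
      by blast
  qed
  moreover have "(1::real) \<in> closure {0..<1}" by simp
  ultimately obtain l where "(?\<phi> \<longlongrightarrow> l) (at 1 within {0..<1})"
    by (rule uniformly_continuous_on_extension_at_closure)
  moreover have "at 1 within {0..<1} = at_left (1::real)"
    by (rule at_within_nhd[of _ "{0<..}"]) auto
  ultimately show ?thesis by auto
qed

lemma radial_bound:
  assumes "radial_energy t < \<infinity>" "0 \<le> r" "r < 1"
  shows "(cmod (eval_fps f (of_real r * cis t)))\<^sup>2 \<le> 2 * (cmod (a 0))\<^sup>2 + 2 * enn2real (radial_energy t)"
proof -
  define e where "e = enn2real (radial_energy t)"
  have e: "radial_energy t = ennreal e" "e \<ge> 0" using assms by (simp_all add: e_def)
  let ?x = "eval_fps f (of_real r * cis t)"
  have "ennreal ((cmod (?x - a 0))\<^sup>2) \<le> ennreal (r * e)"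
    using radial_variation[of 0 r t] assms e by (simp add: eval_fps_at_0 ennreal_mult)
  then have "(cmod (?x - a 0))\<^sup>2 \<le> r * e" using e assms by simp
  also have "\<dots> \<le> 1 * e" using e assms by (intro mult_right_mono) auto
  finally have "(cmod (?x - a 0))\<^sup>2 \<le> e" by simp
  moreover have "(cmod ?x)\<^sup>2 \<le> 2 * (cmod (a 0))\<^sup>2 + 2 * (cmod (?x - a 0))\<^sup>2"
    using cmod_add_power2_le[of "a 0" "?x - a 0"] by simp
  ultimately show ?thesis unfolding e_def[symmetric] by linarith
qed

text \<open>
  The interchange of sum and limit is Tannery's theorem; the limit series is a majorant.
\<close>

lemma square_shift_Abel_limit:
  "((\<lambda>r. \<Sum>n. (a (n + k) * of_real r ^ (n + k)) * cnj (a n * of_real r ^ n))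
     \<longlongrightarrow> (\<Sum>n. a (n + k) * cnj (a n))) (at_left 1)"
proof -
  let ?F = "at_left (1::real)"
  have "((\<lambda>r. \<Sum>n. (a (n + k) * of_real r ^ (n + k)) * cnj (a n * of_real r ^ n))
     \<longlongrightarrow> (\<Sum>n. (a (n + k) * of_real 1 ^ (n + k)) * cnj (a n * of_real 1 ^ n))) ?F"
  proof (rule tannerys_theorem[THEN conjunct2, THEN conjunct2])
    show "summable (\<lambda>n. cmod (a (n + k) * cnj (a n)))"
      by (rule summable_shift_mult_cnj[OF square_summable])
    show "((\<lambda>r. (a (n + k) * of_real r ^ (n + k)) * cnj (a n * of_real r ^ n))
      \<longlongrightarrow> (a (n + k) * of_real 1 ^ (n + k)) * cnj (a n * of_real 1 ^ n)) ?F" for n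
      by (intro tendsto_intros)
    have "\<forall>\<^sub>F r in ?F. r \<in> {0<..<1}" by (rule eventually_at_left_real) simp
    then have ev: "\<forall>\<^sub>F r in ?F. \<forall>n. norm ((a (n + k) * of_real r ^ (n + k)) * cnj (a n * of_real r ^ n))
        \<le> cmod (a (n + k) * cnj (a n))"
    proof eventually_elim
      case (elim r)
      show ?case
      proof
        fix n
        have "r ^ (n + k) * r ^ n \<le> 1"
          using elim by (intro mult_le_one power_le_one) auto
        then have "cmod (a (n + k)) * cmod (a n) * (r ^ (n + k) * r ^ n) \<le> cmod (a (n + k)) * cmod (a n)"
          by (intro mult_left_le) auto
        then show "norm ((a (n + k) * of_real r ^ (n + k)) * cnj (a n * of_real r ^ n))
            \<le> cmod (a (n + k) * cnj (a n))"
          using elim by (simp add: norm_mult norm_power mult_ac)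
      qed
    qed
    show "\<forall>\<^sub>F (n, r) in at_top \<times>\<^sub>F ?F.
        norm ((a (n + k) * of_real r ^ (n + k)) * cnj (a n * of_real r ^ n)) \<le> cmod (a (n + k) * cnj (a n))"
      unfolding eventually_prod_filter
      by (rule exI[of _ "\<lambda>_. True"], rule exI, intro conjI, rule eventually_True, rule ev) simp
  qed simp
  then show ?thesis by simp
qed

text \<open>
  The boundary value is an unspecified constant where the radial limit fails to exist, so its
  measurability is not evident.  \<open>G\<close> is a measurable representative: the limit along one sequence
  of radii.  The bound \<open>radial_bound\<close> is an integrable majorant for all radii at once, which
  carries Parseval from the circles of radius below one to the boundary.
\<close>

lemma boundary_Parseval:
  obtains G where "G \<in> borel_measurable circle_measure"
    and "AE t in circle_measure. boundary_value f (cis t) = G t"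
    and "\<And>k. (\<integral>t. of_real ((cmod (G t))\<^sup>2) * cis (- real k * t) \<partial>circle_measure)
           = 2 * pi * (\<Sum>n. a (n + k) * cnj (a n))"
proof -
  define r where "r m = 1 - 1 / real (Suc m)" for m
  have r: "0 \<le> r m" "r m < 1" for m by (simp_all add: r_def)
  have r_lim: "filterlim r (at_left 1) sequentially"
  proof (rule tendsto_imp_filterlim_at_left)
    have "(\<lambda>m. 1 - 1 / real (Suc m)) \<longlonglongrightarrow> 1 - 0"
      by (intro tendsto_intros LIMSEQ_Suc[OF lim_1_over_n])
    then show "r \<longlonglongrightarrow> 1" by (simp add: r_def[abs_def])
  qed (use r(2) in auto)
  define G where "G t = lim (\<lambda>m. eval_fps f (of_real (r m) * cis t))" for t
  have lim: "boundary_value f (cis t) = G t \<and> (\<lambda>m. eval_fps f (of_real (r m) * cis t)) \<longlonglongrightarrow> G t"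
    if fin: "radial_energy t < \<infinity>" for t
  proof -
    obtain l where l: "((\<lambda>r. eval_fps f (of_real r * cis t)) \<longlongrightarrow> l) (at_left 1)"
      using radial_limit_exists[OF fin] by blast
    have "(\<lambda>m. eval_fps f (of_real (r m) * cis t)) \<longlonglongrightarrow> l"
      by (rule filterlim_compose[OF l r_lim])
    moreover from this have "G t = l" unfolding G_def by (rule limI)
    moreover have "boundary_value f (cis t) = l"
      unfolding boundary_value_def by (rule tendsto_Lim[OF _ l]) simp
    ultimately show ?thesis by simp
  qed
  have G_meas: "G \<in> borel_measurable circle_measure"
    unfolding G_def[abs_def] by measurable
  show ?thesis
  proof (rule that[OF G_meas])
    show "AE t in circle_measure. boundary_value f (cis t) = G t"
      using AE_radial_energy_finite lim by auto
    fix k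
    let ?w = "\<lambda>t. 2 * (cmod (a 0))\<^sup>2 + 2 * enn2real (radial_energy t)"
    show "(\<integral>t. of_real ((cmod (G t))\<^sup>2) * cis (- real k * t) \<partial>circle_measure)
           = 2 * pi * (\<Sum>n. a (n + k) * cnj (a n))"
    proof (rule LIMSEQ_unique)
      show "(\<lambda>m. \<integral>t. of_real ((cmod (eval_fps f (of_real (r m) * cis t)))\<^sup>2) * cis (- real k * t) \<partial>circle_measure)
          \<longlonglongrightarrow> (\<integral>t. of_real ((cmod (G t))\<^sup>2) * cis (- real k * t) \<partial>circle_measure)"
      proof (rule integral_dominated_convergence[where w = ?w])
        show "integrable circle_measure ?w"
        proof (intro Bochner_Integration.integrable_add integrable_mult_right integrable_const)
          show "integrable circle_measure (\<lambda>t. enn2real (radial_energy t))"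
          proof (rule integrableI_bounded)
            have "(\<integral>\<^sup>+t. ennreal (norm (enn2real (radial_energy t))) \<partial>circle_measure)
                \<le> (\<integral>\<^sup>+t. radial_energy t \<partial>circle_measure)"
              by (intro nn_integral_mono) (simp add: ennreal_enn2real_if)
            then show "(\<integral>\<^sup>+t. ennreal (norm (enn2real (radial_energy t))) \<partial>circle_measure) < \<infinity>"
              using integral_radial_energy_finite by (rule le_less_trans)
          qed measurable
        qed simp
        show "AE t in circle_measure. (\<lambda>m. of_real ((cmod (eval_fps f (of_real (r m) * cis t)))\<^sup>2) * cis (- real k * t))
            \<longlonglongrightarrow> of_real ((cmod (G t))\<^sup>2) * cis (- real k * t)"
          using AE_radial_energy_finite
        proof eventually_elim
          case (elim t)
          then show ?case using lim[OF elim] by (intro tendsto_intros) auto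
        qed
        show "AE t in circle_measure. norm (of_real ((cmod (eval_fps f (of_real (r m) * cis t)))\<^sup>2) * cis (- real k * t)) \<le> ?w t" for m
          using AE_radial_energy_finite
        proof eventually_elim
          case (elim t)
          show ?case using radial_bound[OF elim r[of m]] by (simp add: norm_mult norm_power)
        qed
        show "(\<lambda>t. of_real ((cmod (G t))\<^sup>2) * cis (- real k * t)) \<in> borel_measurable circle_measure"
          using G_meas by measurable
        show "(\<lambda>t. of_real ((cmod (eval_fps f (of_real (r m) * cis t)))\<^sup>2) * cis (- real k * t))
            \<in> borel_measurable circle_measure" for m
          by measurable
      qed
      show "(\<lambda>m. \<integral>t. of_real ((cmod (eval_fps f (of_real (r m) * cis t)))\<^sup>2) * cis (- real k * t) \<partial>circle_measure)
          \<longlonglongrightarrow> 2 * pi * (\<Sum>n. a (n + k) * cnj (a n))"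
        unfolding Parseval_fps_circle[OF conv_radius_ge_1 r] fps_nth_Abs_fps
        by (intro tendsto_intros filterlim_compose[OF square_shift_Abel_limit r_lim])
    qed
  qed
qed

end

text \<open>
  The sum on the left is, up to the factor \<open>2 pi\<close>, the \<open>k\<close>-th Fourier coefficient of the constant
  \<open>c\<close>.  The terms of the series that represents \<open>c\<close> are nonnegative, so \<open>c\<close> itself dominates the
  partial sums and the series may be integrated termwise.
\<close>

lemma boundary_square_sum_const_imp_orthogonal:
  fixes a :: "nat \<Rightarrow> complex"
  assumes a: "summable (\<lambda>n. real (Suc n) * (cmod (a n))\<^sup>2)"
    and c: "ae_circle (\<lambda>w. (\<lambda>j. (cmod (boundary_value (Abs_fps (\<lambda>n. a (n + j))) w))\<^sup>2) sums c)"
    and k: "k \<ge> 1"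
  shows "(\<lambda>j. \<Sum>n. a (n + k + j) * cnj (a (n + j))) sums 0"
proof -
  have dir: "dirichlet_coeffs (\<lambda>n. a (n + j))" for j
  proof
    have "summable (\<lambda>n. real (Suc (n + j)) * (cmod (a (n + j)))\<^sup>2)"
      using a by (subst summable_iff_shift)
    then show "summable (\<lambda>n. real (Suc n) * (cmod (a (n + j)))\<^sup>2)"
      by (rule summable_comparison_test') (simp add: mult_right_mono)
  qed
  have "\<exists>G. G \<in> borel_measurable circle_measure \<and>
     (AE t in circle_measure. boundary_value (Abs_fps (\<lambda>n. a (n + j))) (cis t) = G t) \<and>
     (\<integral>t. of_real ((cmod (G t))\<^sup>2) * cis (- real k * t) \<partial>circle_measure)
           = 2 * pi * (\<Sum>n. a (n + k + j) * cnj (a (n + j)))" for j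
    by (rule dirichlet_coeffs.boundary_Parseval[OF dir[of j]]) (auto simp: add_ac)
  then obtain G where G [measurable]: "\<And>j. G j \<in> borel_measurable circle_measure"
    and bv: "\<And>j. AE t in circle_measure. boundary_value (Abs_fps (\<lambda>n. a (n + j))) (cis t) = G j t"
    and int: "\<And>j. (\<integral>t. of_real ((cmod (G j t))\<^sup>2) * cis (- real k * t) \<partial>circle_measure)
           = 2 * pi * (\<Sum>n. a (n + k + j) * cnj (a (n + j)))"
    using choice[of "\<lambda>j G. G \<in> borel_measurable circle_measure \<and>
     (AE t in circle_measure. boundary_value (Abs_fps (\<lambda>n. a (n + j))) (cis t) = G t) \<and>
     (\<integral>t. of_real ((cmod (G t))\<^sup>2) * cis (- real k * t) \<partial>circle_measure)
           = 2 * pi * (\<Sum>n. a (n + k + j) * cnj (a (n + j)))"] by blast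
  have "AE t in circle_measure. \<forall>j. boundary_value (Abs_fps (\<lambda>n. a (n + j))) (cis t) = G j t"
    using bv by (simp add: AE_all_countable)
  then have sums: "AE t in circle_measure. (\<lambda>j. (cmod (G j t))\<^sup>2) sums c"
    using c unfolding ae_circle_iff by eventually_elim simp
  let ?e = "\<lambda>t. cis (- real k * t)"
  let ?p = "\<lambda>J t. of_real (\<Sum>j<J. (cmod (G j t))\<^sup>2) * ?e t"
  have bound: "AE t in circle_measure. \<forall>J. (\<Sum>j<J. (cmod (G j t))\<^sup>2) \<le> c"
    using sums by eventually_elim (auto simp: sums_iff intro!: sum_le_suminf)
  have G_bound: "AE t in circle_measure. (cmod (G j t))\<^sup>2 \<le> c" for j
    using bound
  proof eventually_elim
    case (elim t)
    have "(cmod (G j t))\<^sup>2 \<le> (\<Sum>i<Suc j. (cmod (G i t))\<^sup>2)" by (simp add: sum_nonneg)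
    then show ?case using elim order_trans by blast
  qed
  have "(\<lambda>J. integral\<^sup>L circle_measure (?p J)) \<longlonglongrightarrow> (\<integral>t. of_real c * ?e t \<partial>circle_measure)"
  proof (rule integral_dominated_convergence[where w = "\<lambda>_. c"])
    show "AE t in circle_measure. (\<lambda>J. ?p J t) \<longlonglongrightarrow> of_real c * ?e t"
      using sums
    proof eventually_elim
      case (elim t)
      then show ?case unfolding sums_def by (intro tendsto_intros)
    qed
    show "AE t in circle_measure. norm (?p J t) \<le> c" for J
      using bound
    proof eventually_elim
      case (elim t)
      then show ?case by (simp add: norm_mult sum_nonneg del: of_real_sum)
    qed
    show "?p J \<in> borel_measurable circle_measure" for J by measurable
    show "(\<lambda>t. of_real c * ?e t) \<in> borel_measurable circle_measure" by measurable
  qed simp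
  also have "(\<integral>t. of_real c * ?e t \<partial>circle_measure) = 0"
    using integral_cis_circle[of "- int k"] k by simp
  also have "(\<lambda>J. integral\<^sup>L circle_measure (?p J))
      = (\<lambda>J. \<Sum>j<J. 2 * pi * (\<Sum>n. a (n + k + j) * cnj (a (n + j))))"
  proof
    fix J
    have "integral\<^sup>L circle_measure (?p J)
        = (\<integral>t. (\<Sum>j<J. of_real ((cmod (G j t))\<^sup>2) * ?e t) \<partial>circle_measure)"
      by (simp add: sum_distrib_right)
    also have "\<dots> = (\<Sum>j<J. \<integral>t. of_real ((cmod (G j t))\<^sup>2) * ?e t \<partial>circle_measure)"
    proof (rule Bochner_Integration.integral_sum)
      fix j
      show "integrable circle_measure (\<lambda>t. of_real ((cmod (G j t))\<^sup>2) * ?e t)"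
        by (rule circle.integrable_const_bound[of _ c])
          (use G_bound[of j] in \<open>simp_all add: norm_mult norm_power\<close>)
    qed
    finally show "integral\<^sup>L circle_measure (?p J)
        = (\<Sum>j<J. 2 * pi * (\<Sum>n. a (n + k + j) * cnj (a (n + j))))"
      by (simp only: int)
  qed
  finally have "(\<lambda>j. 2 * pi * (\<Sum>n. a (n + k + j) * cnj (a (n + j)))) sums 0"
    by (simp only: sums_def)
  from sums_mult[OF this, of "1 / (2 * pi)"] show ?thesis by simp
qed

section \<open>Orthogonality and the invariant subspace\<close>

lemma coeff2_shift_z_funpow: "coeff2 ((shift_z ^^ k) q) i j = coeff2 q (i + k) j"
  by (induction k arbitrary: i) simp_all

lemma backward_shift_funpow: "(backward_shift ^^ j) f = Abs_fps (\<lambda>n. fps_nth f (n + j))"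
  by (induction j arbitrary: f) (simp_all add: backward_shift_def fps_eq_iff funpow_swap1)

text \<open>
  There are \<open>n + 1\<close> index pairs of total degree \<open>n\<close>, and by \<open>H_space_coeff\<close> they all carry the same
  coefficient.
\<close>

lemma H_space_dirichlet_summable:
  assumes "q \<in> H_space"
  shows "summable (\<lambda>n. real (Suc n) * (cmod (coeff2 q 0 n))\<^sup>2)"
proof (rule bounded_imp_summable)
  fix N
  let ?A = "Sigma {..N} (\<lambda>n. {..n}) :: (nat \<times> nat) set"
  have inj: "inj_on (\<lambda>(n, i). (i, n - i)) ?A" by (auto simp: inj_on_def)
  have "(\<Sum>n\<le>N. real (Suc n) * (cmod (coeff2 q 0 n))\<^sup>2) = (\<Sum>n\<le>N. \<Sum>i\<le>n. (cmod (coeff2 q 0 n))\<^sup>2)"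
    by simp
  also have "\<dots> = (\<Sum>(n, i)\<in>?A. (cmod (coeff2 q 0 n))\<^sup>2)"
    by (rule sum.Sigma) auto
  also have "\<dots> = (\<Sum>(n, i)\<in>?A. (cmod (coeff_fun q (i, n - i)))\<^sup>2)"
    by (intro sum.cong refl) (auto simp: coeff_fun_def H_space_coeff[OF assms, of _ "_ - _"])
  also have "\<dots> = (\<Sum>p\<in>(\<lambda>(n, i). (i, n - i)) ` ?A. (cmod (coeff_fun q p))\<^sup>2)"
    by (subst sum.reindex[OF inj]) (simp add: case_prod_unfold)
  also have "\<dots> \<le> (norm2 q)\<^sup>2"
    by (rule finite_sum_le_norm2[OF H_space_hardy[OF assms]]) auto
  finally show "(\<Sum>n\<le>N. real (Suc n) * (cmod (coeff2 q 0 n))\<^sup>2) \<le> (norm2 q)\<^sup>2" .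
qed simp

text \<open>
  For \<open>q\<close> with coefficients \<open>a\<close>, the row with index \<open>i\<close> of the double series for
  \<open>inner2 ((shift_z ^^ k) q) q\<close> is the \<open>i\<close>-th term of the series in
  \<open>boundary_square_sum_const_imp_orthogonal\<close>; absolute convergence allows summation by rows.
\<close>

lemma const_square_sum_imp_orthogonal:
  assumes q: "q \<in> H_space" and k: "k \<ge> 1"
    and c: "ae_circle (\<lambda>w. (\<lambda>j. (cmod (boundary_value ((backward_shift ^^ j) (at_z_zero q)) w))\<^sup>2) sums c)"
  shows "inner2 q ((bergman_shift ^^ k) q) = 0"
proof -
  let ?a = "coeff2 q 0"
  define g where "g i j = ?a (j + k + i) * cnj (?a (j + i))" for i j
  have Sq: "(shift_z ^^ k) q \<in> hardy_bidisc"
    by (intro H_space_hardy funpow_H_space shift_z_H_space q)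
  have g: "(\<lambda>p. coeff_fun ((shift_z ^^ k) q) p * cnj (coeff_fun q p)) = (\<lambda>(i, j). g i j)"
  proof (intro ext, clarify)
    fix i j
    have "coeff2 q (i + k) j = ?a (j + k + i)" "coeff2 q i j = ?a (j + i)"
      by (subst H_space_coeff[OF q], simp add: add_ac)+
    then show "coeff_fun ((shift_z ^^ k) q) (i, j) * cnj (coeff_fun q (i, j)) = g i j"
      by (simp add: coeff_fun_def coeff2_shift_z_funpow g_def)
  qed
  have summ: "(\<lambda>(i, j). g i j) summable_on UNIV \<times> UNIV"
    using inner2_summable[OF Sq H_space_hardy[OF q]] by (simp add: g)
  have row: "(\<Sum>\<^sub>\<infinity>j. g i j) = (\<Sum>n. ?a (n + k + i) * cnj (?a (n + i)))" for i
  proof -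
    have "g i summable_on UNIV" using summable_on_SigmaD1[OF summ, of i] by simp
    from has_sum_imp_sums[OF has_sum_infsum[OF this]] show ?thesis
      by (simp add: sums_iff g_def[abs_def])
  qed
  have "(\<lambda>i. \<Sum>n. ?a (n + k + i) * cnj (?a (n + i))) sums 0"
    by (rule boundary_square_sum_const_imp_orthogonal[OF H_space_dirichlet_summable[OF q] _ k])
      (use c in \<open>simp add: backward_shift_funpow at_z_zero_def\<close>)
  moreover have "((\<lambda>i. \<Sum>\<^sub>\<infinity>j. g i j) has_sum (\<Sum>\<^sub>\<infinity>i. \<Sum>\<^sub>\<infinity>j. g i j)) UNIV"
    using summable_on_Sigma_banach[OF summ] by (rule has_sum_infsum)
  then have "(\<lambda>i. \<Sum>n. ?a (n + k + i) * cnj (?a (n + i))) sums (\<Sum>\<^sub>\<infinity>i. \<Sum>\<^sub>\<infinity>j. g i j)"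
    unfolding row by (rule has_sum_imp_sums)
  ultimately have "(\<Sum>\<^sub>\<infinity>i. \<Sum>\<^sub>\<infinity>j. g i j) = 0" by (rule sums_unique2[symmetric])
  then have "inner2 ((shift_z ^^ k) q) q = 0"
    unfolding inner2_eq g using infsum_Sigma'_banach[OF summ] by simp
  then show ?thesis by (simp add: inner2_bergman_shift_funpow[OF q q])
qed

text \<open>
  Polarization: expanding the form at \<open>q + r\<close> and at \<open>q + \<i> r\<close> gives two linear relations between
  \<open>inner2 (T q) r\<close> and \<open>inner2 (T r) q\<close>, which have only the zero solution.
\<close>

lemma inner2_eq_0_by_polarization:
  assumes zero: "\<And>q. q \<in> W \<Longrightarrow> inner2 (T q) q = 0"
    and W: "closed_subspace W"
    and T: "\<And>q. q \<in> W \<Longrightarrow> T q \<in> hardy_bidisc"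
    and add: "\<And>q r. q \<in> W \<Longrightarrow> r \<in> W \<Longrightarrow> T (q + r) = T q + T r"
    and scale: "\<And>c q. q \<in> W \<Longrightarrow> T (scale2 c q) = scale2 c (T q)"
    and q: "q \<in> W" and r: "r \<in> W"
  shows "inner2 (T q) r = 0"
proof -
  note WD = closed_subspaceD[OF W]
  have Wh: "x \<in> W \<Longrightarrow> x \<in> hardy_bidisc" for x using WD(1) by auto
  have sum: "inner2 (T x) y + inner2 (T y) x = 0" if "x \<in> W" "y \<in> W" for x y
  proof -
    have "inner2 (T (x + y)) (x + y) = 0" by (intro zero WD(3) that)
    then show ?thesis
      using that zero[OF that(1)] zero[OF that(2)]
      by (simp add: add inner2_add_left inner2_add_right T Wh add.commute)
  qed
  have "inner2 (T q) (scale2 \<i> r) + inner2 (T (scale2 \<i> r)) q = 0"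
    by (intro sum q WD(4) r)
  then have "- \<i> * inner2 (T q) r + \<i> * inner2 (T r) q = 0"
    by (simp add: scale[OF r] inner2_scale2_left inner2_scale2_right)
  then have "inner2 (T r) q = inner2 (T q) r" by simp
  with sum[OF q r] show ?thesis by simp
qed

theorem theorem2p3:
  fixes W :: "complex fps fps set"
  assumes "closed_subspace W"
    and "W \<subseteq> H_space"
    and "\<forall>q\<in>W. \<exists>c::real. ae_circle (\<lambda>w.
           (\<lambda>j. (cmod (boundary_value ((backward_shift ^^ j) (at_z_zero q)) w))\<^sup>2) sums c)"
  shows "\<exists>M. invariant_subspace M \<and> wandering_subspace M = W \<and>
           (\<forall>N. invariant_subspace N \<and> wandering_subspace N = W \<and> N \<subseteq> M \<longrightarrow> N = M)"
proof -
  note W = assms(1) and WH = assms(2)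
  have WHD: "q \<in> W \<Longrightarrow> q \<in> H_space" for q using WH by blast
  let ?S = "\<lambda>k. shift_z ^^ k"
  let ?B = "bergman_shift"
  have S_add: "?S k (f + g) = ?S k f + ?S k g" and S_scale: "?S k (scale2 c f) = scale2 c (?S k f)" for k f g c
    by (induction k) (simp_all add: shift_z_add shift_z_scale2)
  have orth: "inner2 q ((?B ^^ k) r) = 0" if "q \<in> W" "r \<in> W" "k \<ge> 1" for q r k
  proof -
    have "inner2 (?S k q) r = 0"
    proof (rule inner2_eq_0_by_polarization[OF _ W _ _ _ that(1,2)])
      fix q assume q: "q \<in> W"
      show "inner2 (?S k q) q = 0"
        using assms(3) q const_square_sum_imp_orthogonal[OF WHD[OF q] that(3)]
        by (auto simp: inner2_bergman_shift_funpow[OF WHD[OF q] WHD[OF q]])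
      show "?S k q \<in> hardy_bidisc" by (rule H_space_hardy[OF funpow_H_space[OF shift_z_H_space WHD[OF q]]])
    qed (rule S_add, rule S_scale)
    then show ?thesis by (simp add: inner2_bergman_shift_funpow WHD that)
  qed
  define G where "G = (\<Union>k. (?B ^^ k) ` W)"
  define M where "M = closed_span G"
  have GH: "G \<subseteq> H_space" unfolding G_def using funpow_H_space[where T = bergman_shift, OF bergman_shift_H_space] WHD by blast
  then have M: "closed_subspace M"
    unfolding M_def using H_space_hardy by (intro closed_subspace_closed_span) blast
  have MH: "M \<subseteq> H_space" unfolding M_def by (rule closed_span_minimal[OF closed_subspace_H_space GH])
  have GM: "G \<subseteq> M" unfolding M_def by (rule closed_span_superset)
  have G_iter: "(?B ^^ k) q \<in> G" if "q \<in> W" for q k using that unfolding G_def by blast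
  have WG: "q \<in> W \<Longrightarrow> q \<in> G" for q using G_iter[of q 0] by simp
  have "closed_subspace {f \<in> H_space. ?B f \<in> M}"
    by (rule closed_subspace_vimage[OF closed_subspace_H_space M])
      (simp_all add: bergman_shift_H_space H_space_hardy bergman_shift_add bergman_shift_scale2 bergman_shift_contraction)
  moreover have "G \<subseteq> {f \<in> H_space. ?B f \<in> M}"
  proof
    fix f assume f: "f \<in> G"
    then obtain k q where "q \<in> W" "f = (?B ^^ k) q" unfolding G_def by blast
    then have "?B f \<in> G" using G_iter[of q "Suc k"] by simp
    with f show "f \<in> {f \<in> H_space. ?B f \<in> M}" using GM GH by blast
  qed
  ultimately have "M \<subseteq> {f \<in> H_space. ?B f \<in> M}" unfolding M_def by (rule closed_span_minimal)
  then have BM: "f \<in> M \<Longrightarrow> ?B f \<in> M" for f by blast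
  have inv: "invariant_subspace M"
    unfolding invariant_subspace_def using M MH BM by blast
  \<comment> \<open>For \<open>f\<close> in \<open>G\<close> this is \<open>orth\<close>.  The adjoint turns it into orthogonality of \<open>f\<close> to the fixed
    vector \<open>shift_z q\<close>, a closed condition on \<open>f\<close>, so it passes to the closed span.\<close>
  have W_orth: "inner2 q (?B f) = 0" if q: "q \<in> W" and f: "f \<in> M" for q f
  proof -
    have Sq: "shift_z q \<in> hardy_bidisc" by (intro H_space_hardy shift_z_H_space WHD q)
    have "G \<subseteq> {f \<in> hardy_bidisc. inner2 (shift_z q) f = 0}"
    proof
      fix g assume g: "g \<in> G"
      then obtain k r where r: "r \<in> W" "g = (?B ^^ k) r" unfolding G_def by blast
      have gH: "g \<in> H_space" using g GH by blast
      have "inner2 (shift_z q) g = inner2 q ((?B ^^ Suc k) r)"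
        using inner2_bergman_shift[OF WHD[OF q] gH] r by simp
      also have "\<dots> = 0" by (rule orth[OF q r(1)]) simp
      finally show "g \<in> {f \<in> hardy_bidisc. inner2 (shift_z q) f = 0}" using H_space_hardy[OF gH] by simp
    qed
    from closed_span_minimal[OF closed_subspaceI_inner2[OF Sq] this] f
    have "inner2 (shift_z q) f = 0" unfolding M_def by blast
    moreover have "f \<in> H_space" using f MH by blast
    ultimately show ?thesis using inner2_bergman_shift[OF WHD[OF q]] by simp
  qed
  have "wandering_subspace M = W"
  proof (intro equalityI subsetI)
    fix q assume "q \<in> W"
    then show "q \<in> wandering_subspace M"
      unfolding wandering_subspace_def using WG GM W_orth by blast
  next
    fix f assume "f \<in> wandering_subspace M"
    then have f: "f \<in> M" and f_orth: "\<And>g. g \<in> M \<Longrightarrow> inner2 f (?B g) = 0"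
      unfolding wandering_subspace_def by blast+
    have Mh: "g \<in> M \<Longrightarrow> g \<in> hardy_bidisc" for g using MH H_space_hardy by blast
    obtain q where q: "q \<in> W" and fq: "\<And>h. h \<in> W \<Longrightarrow> inner2 (f - q) h = 0"
      using projection_exists[OF W Mh[OF f]] by blast
    have qM: "q \<in> M" using WG[OF q] GM by blast
    have d: "f - q \<in> M" by (rule closed_subspaceD(5)[OF M f qM])
    \<comment> \<open>An element \<open>B\<^sup>k r\<close> of \<open>G\<close> lies in \<open>W\<close> if \<open>k = 0\<close>, where the projection gives orthogonality,
      and in \<open>B M\<close> otherwise, where both \<open>f\<close> and \<open>q\<close> are orthogonal to it.\<close>
    have "G \<subseteq> {h \<in> hardy_bidisc. inner2 (f - q) h = 0}"
    proof
      fix g assume g: "g \<in> G"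
      then obtain k r where r: "r \<in> W" "g = (?B ^^ k) r" unfolding G_def by blast
      have "inner2 (f - q) g = 0"
      proof (cases k)
        case 0
        then show ?thesis using r fq by simp
      next
        case (Suc l)
        define h where "h = (?B ^^ l) r"
        have h: "h \<in> M" unfolding h_def using G_iter[OF r(1)] GM by blast
        have "inner2 (f - q) (?B h) = 0"
          using f_orth[OF h] W_orth[OF q h] Mh[OF f] Mh[OF qM] Mh[OF BM[OF h]]
          by (simp add: inner2_diff_left)
        then show ?thesis using r Suc by (simp add: h_def)
      qed
      moreover have "g \<in> hardy_bidisc" using g GM Mh by blast
      ultimately show "g \<in> {h \<in> hardy_bidisc. inner2 (f - q) h = 0}" by simp
    qed
    from closed_span_minimal[OF closed_subspaceI_inner2[OF Mh[OF d]] this] d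
    have "inner2 (f - q) (f - q) = 0" unfolding M_def by blast
    then have "norm2 (f - q) = 0" using Mh[OF d] by (simp add: inner2_self)
    then have "f = q" using norm2_eq_0D[OF Mh[OF d]] by simp
    with q show "f \<in> W" by simp
  qed
  moreover have "N = M" if N: "invariant_subspace N" "wandering_subspace N = W" "N \<subseteq> M" for N
  proof
    have WN: "W \<subseteq> N" using N(2) unfolding wandering_subspace_def by blast
    have "(?B ^^ k) q \<in> N" if "q \<in> W" for k q
    proof (induction k)
      case 0
      show ?case using that WN by auto
    next
      case (Suc k)
      then show ?case using N(1) unfolding invariant_subspace_def by auto
    qed
    then have "G \<subseteq> N" unfolding G_def by blast
    moreover have "closed_subspace N" using N(1) unfolding invariant_subspace_def by blast
    ultimately show "M \<subseteq> N" unfolding M_def by (intro closed_span_minimal)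
  qed (rule N(3))
  ultimately show ?thesis using inv by blast
qed

end
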